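(* Let $d\in C^1(\mathbb{R})$ with $d(0)=0$, $d'(m)>d_0$ and $|d'(m)|\le d_1+d_2|m|^p$ for all $m\in\mathbb{R}$, for constants $d_0>0$, $d_1,d_2,p\ge0$. Let $\bar f,\bar g\in L^2(0,1)$, $\bar h=(\bar h(0),\bar h(1))\in\mathbb{R}^2$, $p_0,m_0\in H^1(0,1)$, $T>0$, and let $(p,m)\in C(0,T;H^1\times H^1)\cap C^1(0,T;L^2\times L^2)$ be the unique solution of $$\partial_t p+\partial_x m=\bar f,\qquad \partial_t m+\partial_x p+d(m)=\bar g\quad\text{in }(0,1)\times[0,T],\qquad p(x,t)=\bar h(x)\ \text{for }x\in\{0,1\},\ t\in[0,T],$$ with $p(0)=p_0$, $m(0)=m_0$. Let $(\bar p,\bar m)\in H^1(0,1)\times H^1(0,1)$ be the (unique) steady state, i.e. the solution of $\partial_x\bar m=\bar f$, $\partial_x\bar p+d(\bar m)=\bar g$ in $(0,1)$, $\bar p=\bar h$ at $x\in\{0,1\}$. Then for $0\le t\le T$, $$E(p(t)-\bar p,m(t)-\bar m)\le c e^{-\gamma t}\quad\text{and}\quad E(\partial_t p(t),\partial_t m(t))\le c'e^{-\gamma t},$$ with constants $c,c',\gamma>0$ depending only on $\|\bar f\|_{L^2},\|\bar g\|_{L^2},|\bar h|,\|p_0\|_{H^1},\|m_0\|_{H^1}$.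
   Context: $E(q,v):=\tfrac12\|q\|_{L^2}^2+\tfrac12\|v\|_{L^2}^2$. $p(t)$ denotes $x\mapsto p(x,t)$; $|\bar h|$ denotes a norm of $\bar h\in\mathbb{R}^2$. *)

theory Defs
  imports "HOL-Analysis.Analysis"
begin

text \<open>Functions on the interval (0,1) are represented as real-valued functions on the reals;
  only their values on [0,1] matter (up to null sets).\<close>

definition L2 :: "(real \<Rightarrow> real) set" where
  "L2 = {f. f \<in> borel_measurable (lebesgue_on {0..1}) \<and>
            integrable (lebesgue_on {0..1}) (\<lambda>x. (f x)\<^sup>2)}"

definition L2norm :: "(real \<Rightarrow> real) \<Rightarrow> real" where
  "L2norm f = sqrt (integral\<^sup>L (lebesgue_on {0..1}) (\<lambda>x. (f x)\<^sup>2))"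

definition test_fun :: "(real \<Rightarrow> real) \<Rightarrow> bool" where
  "test_fun \<phi> \<longleftrightarrow> (\<forall>k x. ((deriv ^^ k) \<phi>) differentiable (at x)) \<and>
     (\<exists>a b. 0 < a \<and> a \<le> b \<and> b < 1 \<and> (\<forall>x. x \<notin> {a..b} \<longrightarrow> \<phi> x = 0))"

definition weak_deriv :: "(real \<Rightarrow> real) \<Rightarrow> (real \<Rightarrow> real) \<Rightarrow> bool" where
  "weak_deriv f g \<longleftrightarrow> integrable (lebesgue_on {0..1}) f \<and> integrable (lebesgue_on {0..1}) g \<and>
     (\<forall>\<phi>. test_fun \<phi> \<longrightarrow>
        (\<integral>x. f x * deriv \<phi> x \<partial>lebesgue_on {0..1}) = - (\<integral>x. g x * \<phi> x \<partial>lebesgue_on {0..1}))"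

definition H1 :: "(real \<Rightarrow> real) set" where
  "H1 = {f. f \<in> L2 \<and> (\<exists>g\<in>L2. weak_deriv f g)}"

definition H1norm :: "(real \<Rightarrow> real) \<Rightarrow> real" where
  "H1norm f = sqrt ((L2norm f)\<^sup>2 + (L2norm (SOME g. g \<in> L2 \<and> weak_deriv f g))\<^sup>2)"

text \<open>Boundary value (trace) at a point a of [0,1]: the value of the continuous representative.\<close>
definition bval :: "(real \<Rightarrow> real) \<Rightarrow> real \<Rightarrow> real" where
  "bval f a = (THE c. \<exists>g. continuous_on {0..1} g \<and>
                  (AE x in lebesgue_on {0..1}. f x = g x) \<and> g a = c)"

definition Energy :: "(real \<Rightarrow> real) \<Rightarrow> (real \<Rightarrow> real) \<Rightarrow> real" where
  "Energy q v = (L2norm q)\<^sup>2 / 2 + (L2norm v)\<^sup>2 / 2"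

text \<open>|m|^p with the convention 0^0 = 1.\<close>
definition rpow :: "real \<Rightarrow> real \<Rightarrow> real" where
  "rpow x e = (if x = 0 then (if e = 0 then 1 else 0) else x powr e)"

end

theory Submission
  imports Defs
begin

text \<open>The difference \<open>(q, v)\<close> of two solutions with the same data solves a damped wave equation
  with homogeneous boundary values for \<open>q\<close>, and its energy \<open>E\<close> satisfies
  \<open>E' \<le> - d0 \<parallel>v\<parallel>\<^sup>2\<close>. Dissipation of \<open>q\<close> is recovered by the modified energy
  \<open>E - \<epsilon> \<langle>v, Q\<rangle>\<close>, where \<open>Q\<close> is the mean-free primitive of \<open>q\<close>; the admissible \<open>\<epsilon>\<close>, and with it
  the decay rate, depends only on \<open>d0\<close> and on a Lipschitz constant of \<open>d\<close> on the range of the two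
  solutions. Comparison with the steady state gives decay of \<open>(p - pb, m - mb)\<close>; comparison with
  time translates of the solution itself, divided by the time step, gives decay of \<open>(pt, mt)\<close>.
  The first use of the latter, with mere monotonicity of the energy, bounds \<open>\<parallel>pt\<parallel>\<close>, hence
  \<open>\<parallel>mx\<parallel> = \<parallel>fb - pt\<parallel>\<close> and the supremum of \<open>m\<close>, by the data, which makes the Lipschitz constant and
  the rate depend on the data only.\<close>

section \<open>Test functions and the fundamental lemma\<close>

text \<open>Neither \<open>pt\<close> nor \<open>mt\<close> is known to be differentiable in time,
  so the equations cannot be differentiated. Translates work because data and boundary values do not
  depend on time: a translate is again a solution on a shorter interval, and the factors in the
  energy estimates do not depend on the length of that interval. The energy alone controls only L2
  norms, whereas the supremum of \<open>m\<close> needs \<open>mx\<close>, which is reached through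
  the first equation. At time 0 the equations express \<open>pt\<close> and \<open>mt\<close> by the
  data; this is where the H1 norms of the initial values enter. The steady \<open>mb\<close> has no
  boundary condition of its own and is bounded through the mean of \<open>d (mb)\<close> instead.
  Weak derivatives are tested only against smooth functions supported inside the interval, so
  integration by parts up to the boundary must be derived: a function with weak derivative
  \<open>g\<close> is a constant plus \<open>prim g\<close> almost everywhere, and boundary terms
  are read off from primitives.\<close>

abbreviation (input) M01 :: "real measure" where
  "M01 \<equiv> lebesgue_on {0..1}"

text \<open>The classical smooth function exp (-1/x), extended by 0. The powers of x in the
  denominator are included because differentiation produces them: every derivative is a linear
  combination of members of this family.\<close>

definition flat :: "nat \<Rightarrow> real \<Rightarrow> real" where
  "flat k x = (if x \<le> 0 then 0 else exp (- (1 / x)) / x ^ k)"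

lemma flat_tendsto_0: "(flat k \<longlongrightarrow> 0) (at 0)"
proof -
  have "((\<lambda>x::real. (inverse x) ^ k / exp (inverse x)) \<longlongrightarrow> 0) (at_right 0)"
    by (rule filterlim_compose[OF tendsto_power_div_exp_0 filterlim_inverse_at_top_right])
  then have right: "(flat k \<longlongrightarrow> 0) (at_right 0)"
    by (rule Lim_transform_eventually)
       (auto simp: eventually_at_filter flat_def exp_minus field_simps)
  have left: "(flat k \<longlongrightarrow> 0) (at_left 0)"
    by (rule Lim_transform_eventually[OF tendsto_const])
       (auto simp: eventually_at_filter flat_def)
  from left right show ?thesis by (simp add: filterlim_split_at)
qed

lemma flat_has_derivative:
  "(flat k has_real_derivative flat (k + 2) x - real k * flat (k + 1) x) (at x)"
proof (cases x "0::real" rule: linorder_cases)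
  case less
  have "((\<lambda>_. 0) has_real_derivative 0) (at x)" by simp
  then have "(flat k has_real_derivative 0) (at x)"
    by (rule has_field_derivative_transform_within_open[where S = "{..<0}"])
       (use less in \<open>auto simp: flat_def\<close>)
  with less show ?thesis by (simp add: flat_def)
next
  case equal
  \<comment> \<open>The difference quotient of \<open>flat k\<close> at 0 is
    \<open>flat (Suc k)\<close> itself, whose limit is already known.\<close>
  have "((\<lambda>h. flat k h / h) \<longlongrightarrow> 0) (at 0)"
    by (rule Lim_transform_eventually[OF flat_tendsto_0[of "Suc k"]])
       (auto simp: eventually_at_filter flat_def)
  with equal show ?thesis by (simp add: DERIV_def flat_def)
next
  case greater
  have "((\<lambda>x. exp (- (1 / x)) / x ^ k) has_real_derivative
      (flat (k + 2) x - real k * flat (k + 1) x)) (at x)"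
  proof -
    have "((\<lambda>x. exp (- (1 / x)) / x ^ k) has_real_derivative
        (exp (- (1 / x)) * (1 / (x * x)) * x ^ k - exp (- (1 / x)) * (real k * x ^ (k - Suc 0)))
          / (x ^ k * x ^ k)) (at x)"
      by (rule DERIV_divide[OF _ DERIV_pow])
         (use greater in \<open>auto intro!: derivative_eq_intros\<close>)
    moreover have "real k * x ^ (k - Suc 0) = real k * x ^ k / x"
      using greater by (cases k) auto
    moreover have "(exp (- (1 / x)) * (1 / (x * x)) * x ^ k - exp (- (1 / x)) * (real k * x ^ k / x))
        / (x ^ k * x ^ k) = flat (k + 2) x - real k * flat (k + 1) x"
      using greater by (simp add: flat_def divide_simps) (simp add: algebra_simps)
    ultimately show ?thesis by simp
  qed
  then show ?thesis
    by (rule has_field_derivative_transform_within_open[where S = "{0<..}"])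
       (use greater in \<open>auto simp: flat_def\<close>)
qed

lemma flat_0_nonneg: "0 \<le> flat 0 x"
  and flat_0_le_1: "flat 0 x \<le> 1"
  by (auto simp: flat_def)

text \<open>A linear space of functions that contains the bumps and is closed under differentiation.
  Smoothness of all orders then follows by induction, without computing a higher derivative.\<close>

inductive_set bumps :: "real \<Rightarrow> real \<Rightarrow> (real \<Rightarrow> real) set" for a b where
  flat: "(\<lambda>x. flat k (r * (x - a)) * flat l (r * (b - x))) \<in> bumps a b"
| lin: "f \<in> bumps a b \<Longrightarrow> g \<in> bumps a b \<Longrightarrow> (\<lambda>x. u * f x + v * g x) \<in> bumps a b"

lemma bumps_derivative:
  assumes "f \<in> bumps a b"
  shows "\<exists>f'\<in>bumps a b. \<forall>x. (f has_real_derivative f' x) (at x)"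
  using assms
proof induction
  case (flat k r l)
  let ?F = "\<lambda>k x. flat k (r * (x - a))" and ?G = "\<lambda>l x. flat l (r * (b - x))"
  have "(\<lambda>x. 1 * (r * (?F (k+2) x * ?G l x) + (- r * k) * (?F (k+1) x * ?G l x)) +
       1 * ((- r) * (?F k x * ?G (l+2) x) + (r * l) * (?F k x * ?G (l+1) x))) \<in> bumps a b"
    by (intro bumps.intros)
  moreover have "((\<lambda>x. ?F k x * ?G l x) has_real_derivative
      1 * (r * (?F (k+2) x * ?G l x) + (- r * k) * (?F (k+1) x * ?G l x)) +
       1 * ((- r) * (?F k x * ?G (l+2) x) + (r * l) * (?F k x * ?G (l+1) x))) (at x)" for x
  proof -
    have 1: "(?F k has_real_derivative (?F (k+2) x - k * ?F (k+1) x) * r) (at x)"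
      by (rule DERIV_chain2[OF flat_has_derivative]) (auto intro!: derivative_eq_intros)
    have 2: "(?G l has_real_derivative (?G (l+2) x - l * ?G (l+1) x) * (- r)) (at x)"
      by (rule DERIV_chain2[OF flat_has_derivative]) (auto intro!: derivative_eq_intros)
    show ?thesis
      using DERIV_mult[OF 1 2] by (simp add: algebra_simps)
  qed
  ultimately show ?case by (intro bexI allI)
next
  case (lin f g u v)
  then obtain f' g' where fg: "f' \<in> bumps a b" "g' \<in> bumps a b"
    "\<And>x. (f has_real_derivative f' x) (at x)" "\<And>x. (g has_real_derivative g' x) (at x)"
    by blast
  show ?case
    by (rule bexI[of _ "\<lambda>x. u * f' x + v * g' x"])
       (auto intro!: derivative_eq_intros bumps.lin fg)
qed

lemma bumps_higher_deriv:
  assumes "f \<in> bumps a b"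
  shows "(deriv ^^ k) f \<in> bumps a b"
proof (induction k)
  case (Suc k)
  from bumps_derivative[OF Suc] obtain f' where
    f': "f' \<in> bumps a b" "\<And>x. ((deriv ^^ k) f has_real_derivative f' x) (at x)"
    by blast
  then have "deriv ((deriv ^^ k) f) = f'" by (auto intro!: DERIV_imp_deriv)
  with f' show ?case by simp
qed (use assms in simp)

text \<open>The scale \<open>n\<close> steepens the flanks: the support stays in [a, b] and the
  values stay in [0, 1], while the functions converge pointwise to the indicator of the open
  interval.\<close>

definition bump :: "real \<Rightarrow> real \<Rightarrow> nat \<Rightarrow> real \<Rightarrow> real" where
  "bump a b n x = flat 0 (real n * (x - a)) * flat 0 (real n * (b - x))"

lemma test_fun_bump:
  assumes "0 < a" "a < b" "b < 1"
  shows "test_fun (bump a b n)"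
proof -
  have "bump a b n \<in> bumps a b"
    unfolding bump_def[abs_def] by (rule bumps.flat)
  then have "(deriv ^^ k) (bump a b n) differentiable (at x)" for k x
    using bumps_derivative[OF bumps_higher_deriv] real_differentiable_def by blast
  moreover have "bump a b n x = 0" if "x \<notin> {a..b}" for x
    using that by (auto simp: bump_def flat_def mult_le_0_iff not_le)
  ultimately show ?thesis
    unfolding test_fun_def using assms by (meson less_imp_le)
qed

lemma bump_nonneg: "0 \<le> bump a b n x" and bump_le_1: "bump a b n x \<le> 1"
  by (auto simp: bump_def flat_0_nonneg flat_0_le_1 mult_le_one)

lemma bump_tendsto:
  "(\<lambda>n. bump a b n x) \<longlonglongrightarrow> indicator {a<..<b} x"
proof -
  have flat_lim: "(\<lambda>n. flat 0 (real n * y)) \<longlonglongrightarrow> indicator {0<..} y" for y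
  proof (cases "y > 0")
    case True
    have "(\<lambda>n. exp (- (1 / y * (1 / real n)))) \<longlonglongrightarrow> exp (- (1 / y * 0))"
      by (intro tendsto_intros lim_1_over_n)
    then have "(\<lambda>n. exp (- (1 / (real n * y)))) \<longlonglongrightarrow> 1" by (simp add: field_simps)
    then have "(\<lambda>n. flat 0 (real n * y)) \<longlonglongrightarrow> 1"
      by (rule Lim_transform_eventually)
         (use True eventually_gt_at_top[of 0] in \<open>auto elim!: eventually_mono simp: flat_def mult_le_0_iff\<close>)
    with True show ?thesis by simp
  next
    case False
    then have "flat 0 (real n * y) = 0" for n
      by (auto simp: flat_def mult_nonneg_nonpos)
    with False show ?thesis by simp
  qed
  have "(\<lambda>n. bump a b n x) \<longlonglongrightarrow> indicator {0<..} (x - a) * indicator {0<..} (b - x)"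
    unfolding bump_def by (intro tendsto_intros flat_lim)
  then show ?thesis by (cases "a < x"; cases "x < b") (simp_all add: indicator_def)
qed

lemma test_fun_has_derivative: "test_fun \<phi> \<Longrightarrow> (\<phi> has_real_derivative deriv \<phi> x) (at x)"
  unfolding test_fun_def
  by (metis DERIV_deriv_iff_real_differentiable funpow_0)

lemma test_fun_continuous_on:
  assumes "test_fun \<phi>" shows "continuous_on S \<phi>"
  using test_fun_has_derivative[OF assms] by (meson DERIV_continuous_on has_field_derivative_at_within)

lemma test_fun_deriv_continuous_on:
  assumes "test_fun \<phi>" shows "continuous_on S (deriv \<phi>)"
proof -
  have "deriv \<phi> differentiable (at x)" for x
    using assms unfolding test_fun_def by (metis funpow_0 funpow_simps_right(2) comp_apply)
  then show ?thesis
    by (meson continuous_at_imp_continuous_on differentiable_imp_continuous_within)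
qed

text \<open>The vanishing mean makes the primitive return to 0 to the right of the support of
  \<open>\<psi>\<close>, so it is again compactly supported in the open interval.\<close>

lemma test_fun_primitive:
  assumes diff: "\<And>k x. ((deriv ^^ k) \<psi>) differentiable (at x)"
    and ab: "0 < a" "a \<le> b" "b < 1" and supp: "\<And>x. x \<notin> {a..b} \<Longrightarrow> \<psi> x = 0"
    and mean: "integral {0..1} \<psi> = 0"
  obtains \<phi> where "test_fun \<phi>" "deriv \<phi> = \<psi>"
proof -
  define \<phi> where "\<phi> x = integral {0..x} \<psi>" for x
  have cont: "continuous_on S \<psi>" for S
    using diff[of 0] by (auto intro!: continuous_at_imp_continuous_on differentiable_imp_continuous_within)
  have int: "\<psi> integrable_on {u..v}" for u v
    by (rule integrable_continuous_real[OF cont])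
  have zero: "integral {u..v} \<psi> = 0" if "v \<le> 0 \<or> 1 \<le> u" for u v
  proof -
    have "integral {u..v} \<psi> = integral {u..v} (\<lambda>_. 0)"
      using that ab by (intro integral_cong supp) auto
    then show ?thesis by simp
  qed
  \<comment> \<open>For x < 0 the interval {0..x} is empty. A lower limit far to the left gives the
    same function and makes every point interior, so that the fundamental theorem yields a two-sided
    derivative.\<close>
  have shift: "\<phi> x = integral {-N..x} \<psi>" if "N \<ge> 0" for x N
  proof (cases "x \<ge> 0")
    case True
    with that show ?thesis
      using Henstock_Kurzweil_Integration.integral_combine[of "-N" 0 x \<psi>] int zero[of 0 "-N"]
      by (simp add: \<phi>_def)
  next
    case False
    then show ?thesis by (simp add: \<phi>_def zero)
  qed
  have der: "(\<phi> has_real_derivative \<psi> x) (at x)" for x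
  proof -
    define N where "N = \<bar>x\<bar> + 1"
    have "((\<lambda>x. integral {-N..x} \<psi>) has_real_derivative \<psi> x) (at x within {-N..N})"
      by (rule integral_has_real_derivative[OF cont]) (auto simp: N_def)
    moreover have "at x within {-N..N} = at x"
      by (rule at_within_interior) (auto simp: N_def)
    moreover have "(\<lambda>x. integral {-N..x} \<psi>) = \<phi>"
      using shift[of N] by (auto simp: N_def)
    ultimately show ?thesis by simp
  qed
  then have deriv: "deriv \<phi> = \<psi>" by (auto intro!: DERIV_imp_deriv)
  have "\<phi> x = 0" if "x \<notin> {a..b}" for x
  proof (cases "x < a")
    case True
    have "integral {0..x} \<psi> = integral {0..x} (\<lambda>_. 0)"
      using True by (intro integral_cong supp) auto
    then show ?thesis by (simp add: \<phi>_def)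
  next
    case False
    with that have x: "x > b" by simp
    have tail: "integral {u..v} \<psi> = 0" if "u \<ge> x" for u v
    proof -
      have "integral {u..v} \<psi> = integral {u..v} (\<lambda>_. 0)"
        using x that by (intro integral_cong supp) auto
      then show ?thesis by simp
    qed
    have "integral {0..max x 1} \<psi> = \<phi> x"
      using Henstock_Kurzweil_Integration.integral_combine[of 0 x "max x 1" \<psi>] int x ab tail[of x "max x 1"]
      by (simp add: \<phi>_def)
    moreover have "integral {0..max x 1} \<psi> = 0"
      using Henstock_Kurzweil_Integration.integral_combine[of 0 1 "max x 1" \<psi>] int mean zero[of "max x 1" 1]
      by simp
    ultimately show ?thesis by simp
  qed
  moreover have "((deriv ^^ k) \<phi>) differentiable (at x)" for k x
  proof (cases k)
    case 0
    then show ?thesis using der real_differentiable_def by auto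
  next
    case (Suc j)
    then show ?thesis using diff[of j x] deriv by (simp add: funpow_swap1)
  qed
  ultimately have "test_fun \<phi>" unfolding test_fun_def using ab by blast
  then show ?thesis using deriv by (rule that)
qed


section \<open>Lebesgue measure on the unit interval and the fundamental lemma\<close>

interpretation M01: finite_measure M01
  by (rule finite_measure_lebesgue_on) auto

lemma measure_M01 [simp]: "measure M01 {0..1} = 1"
  by (simp add: measure_restrict_space)

lemma AE_M01I: "(\<And>x. x \<in> {0..1} \<Longrightarrow> P x) \<Longrightarrow> AE x in M01. P x"
  by (rule AE_I2) simp

lemma AE_M01_neq: "AE x in M01. x \<noteq> a"
proof -
  have "AE x in lebesgue. x \<noteq> a"
    by (rule AE_I'[of "{a}"]) auto
  then show ?thesis by (auto simp: AE_restrict_space_iff)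
qed

lemma borel_measurable_M01 [measurable (raw)]:
  "f \<in> borel_measurable borel \<Longrightarrow> f \<in> borel_measurable M01"
  by (simp add: measurable_completion measurable_restrict_space1)

lemma integrable_M01_mult_bounded:
  fixes w g :: "real \<Rightarrow> real"
  assumes "integrable M01 w" "g \<in> borel_measurable M01" "AE x in M01. \<bar>g x\<bar> \<le> B"
  shows "integrable M01 (\<lambda>x. w x * g x)"
proof (rule Bochner_Integration.integrable_bound)
  show "integrable M01 (\<lambda>x. B * w x)" using assms(1) by simp
  show "(\<lambda>x. w x * g x) \<in> borel_measurable M01" using assms by measurable
  show "AE x in M01. norm (w x * g x) \<le> norm (B * w x)"
    using assms(3) by eventually_elim (auto simp: abs_mult mult.commute[of B] intro!: mult_left_mono)
qed

lemma integrable_M01_indicator: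
  fixes w :: "real \<Rightarrow> real"
  shows "integrable M01 w \<Longrightarrow> A \<in> sets borel \<Longrightarrow> integrable M01 (\<lambda>x. w x * indicator A x)"
  by (rule integrable_M01_mult_bounded[where B = 1]) (auto simp: indicator_def)

lemma integrable_M01_continuous:
  "continuous_on {0..1} f \<Longrightarrow> integrable M01 (f :: real \<Rightarrow> real)"
  by (rule continuous_imp_integrable_real)

text \<open>The integral from 0 to x for x in [0, 1], written with an indicator over the fixed
  measure so that Fubini and dominated convergence apply directly.\<close>

definition prim :: "(real \<Rightarrow> real) \<Rightarrow> real \<Rightarrow> real" where
  "prim g x = (\<integral>y. g y * indicator {..x} y \<partial>M01)"

text \<open>Half lines form an intersection-stable generator of the Borel sets, so vanishing
  integrals over them extend to all Borel sets by the pi-lambda theorem, and to Lebesgue sets up to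
  null sets.\<close>

lemma AE_0_if_prim_0:
  assumes w: "integrable M01 w" and 0: "\<And>x. prim w x = 0"
  shows "AE x in M01. w x = 0"
proof (rule M01.density_zero[OF w])
  have total: "integral\<^sup>L M01 w = 0"
  proof -
    have "integral\<^sup>L M01 w = prim w 1"
      unfolding prim_def by (rule Bochner_Integration.integral_cong) auto
    then show ?thesis using 0 by simp
  qed
  have borel: "(\<integral>x. w x * indicator A x \<partial>M01) = 0" if "A \<in> sets borel" for A
  proof -
    have "Int_stable (range (\<lambda>a::real. {..a}))"
      by (auto simp: Int_stable_def)
    moreover have "range (\<lambda>a::real. {..a}) \<subseteq> Pow UNIV" by simp
    moreover have "A \<in> sigma_sets UNIV (range (\<lambda>a::real. {..a}))"
      using that by (simp add: borel_eq_atMost)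
    ultimately show ?thesis
    proof (induction rule: sigma_sets_induct_disjoint)
      case (basic A)
      then show ?case using 0 by (auto simp: prim_def)
    next
      case empty
      then show ?case by simp
    next
      case (compl A)
      then have "A \<in> sets borel" by (simp add: borel_eq_atMost)
      then have "(\<integral>x. w x - w x * indicator A x \<partial>M01) = 0"
        using compl total w by (simp add: integrable_M01_indicator)
      moreover have "w x * indicator (UNIV - A) x = w x - w x * indicator A x" for x
        by (auto simp: indicator_def)
      ultimately show ?case by simp
    next
      case (union A)
      then have A: "A i \<in> sets borel" for i by (auto simp: borel_eq_atMost)
      have eq: "(\<integral>x. w x * indicator B x \<partial>M01) = (LINT x:B \<inter> {0..1}|M01. w x)" for B
        unfolding set_lebesgue_integral_def
        by (rule Bochner_Integration.integral_cong) (auto simp: indicator_def)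
      have "(LINT x:(\<Union>i. A i \<inter> {0..1})|M01. w x) = (\<Sum>i. (LINT x:(A i \<inter> {0..1})|M01. w x))"
      proof (rule lebesgue_integral_countable_add)
        show m: "A i \<inter> {0..1} \<in> sets M01" for i
          using A by (auto simp: sets_restrict_space_iff)
        show "A i \<inter> {0..1} \<inter> (A j \<inter> {0..1}) = {}" if "i \<noteq> j" for i j
          using union.hyps(1) that by (auto simp: disjoint_family_on_def)
        show "set_integrable M01 (\<Union>i. A i \<inter> {0..1}) w"
          unfolding set_integrable_def by (intro integrable_mult_indicator sets.countable_UN w) (use m in auto)
      qed
      then show ?case using union.IH by (simp add: eq)
    qed
  qed
  fix A assume A: "A \<in> sets M01"
  then have "A \<in> sets lebesgue" and sub: "A \<subseteq> {0..1}" by (auto simp: sets_restrict_space_iff)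
  \<comment> \<open>The measure is complete, so \<open>A\<close> need not be Borel: only the Borel
    part \<open>S\<close> contributes to the integral.\<close>
  then obtain S N N' where SN: "A = S \<union> N" "N \<subseteq> N'" "N' \<in> null_sets lborel" "S \<in> sets lborel"
    by (auto elim: sets_completionE)
  have "AE x in lebesgue. x \<notin> N'"
    using SN(3) by (intro AE_completion AE_not_in)
  then have "AE x in M01. x \<notin> N'" by (auto simp: AE_restrict_space_iff)
  then have "AE x in M01. indicator A x *\<^sub>R w x = w x * indicator S x"
    by eventually_elim (use SN in \<open>auto simp: indicator_def\<close>)
  then have "set_lebesgue_integral M01 A w = (\<integral>x. w x * indicator S x \<partial>M01)"
    unfolding set_lebesgue_integral_def
    using w A SN(4) by (intro integral_cong_AE) auto
  with borel[of S] SN(4) show "set_lebesgue_integral M01 A w = 0" by simp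
qed

text \<open>The fundamental lemma of the calculus of variations. Bumps approximate indicators of
  intervals compactly contained in (0, 1), and these approximate half lines up to null sets; every
  passage to the limit is dominated by the absolute value of \<open>w\<close>.\<close>

lemma AE_0_if_orthogonal_test_fun:
  assumes w: "integrable M01 w"
    and orth: "\<And>\<phi>. test_fun \<phi> \<Longrightarrow> (\<integral>x. w x * \<phi> x \<partial>M01) = 0"
  shows "AE x in M01. w x = 0"
proof (rule AE_0_if_prim_0[OF w])
  have dom: "(\<lambda>n. \<integral>x. w x * s n x \<partial>M01) \<longlonglongrightarrow> (\<integral>x. w x * f x \<partial>M01)"
    if "f \<in> borel_measurable M01" "\<And>n. s n \<in> borel_measurable M01"
      "AE x in M01. (\<lambda>n. s n x) \<longlonglongrightarrow> f x" "\<And>n x. \<bar>s n x\<bar> \<le> 1" for s and f :: "real \<Rightarrow> real"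
  proof (rule integral_dominated_convergence[where w = "\<lambda>x. \<bar>w x\<bar>"])
    show "AE x in M01. (\<lambda>n. w x * s n x) \<longlonglongrightarrow> w x * f x"
      using that(3) by eventually_elim (rule tendsto_mult_left)
    show "AE x in M01. norm (w x * s n x) \<le> \<bar>w x\<bar>" for n
      by (rule AE_I2) (use that(4)[of n] in \<open>auto simp: abs_mult intro: mult_left_le\<close>)
  qed (use that w in auto)
  have open_interval: "(\<integral>x. w x * indicator {a<..<b} x \<partial>M01) = 0" if "0 < a" "a < b" "b < 1" for a b
  proof -
    have "(\<lambda>n. \<integral>x. w x * bump a b n x \<partial>M01) \<longlonglongrightarrow> (\<integral>x. w x * indicator {a<..<b} x \<partial>M01)"
    proof (rule dom)
      show "bump a b n \<in> borel_measurable M01" for n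
        by (intro borel_measurable_M01 borel_measurable_continuous_onI
            test_fun_continuous_on test_fun_bump that)
    qed (auto simp: bump_tendsto bump_nonneg bump_le_1)
    then have "(\<lambda>n. 0) \<longlonglongrightarrow> (\<integral>x. w x * indicator {a<..<b} x \<partial>M01)"
      by (simp add: orth test_fun_bump that)
    then show ?thesis by (simp add: LIMSEQ_const_iff)
  qed
  have mid: "prim w x = 0" if x: "0 < x" "x \<le> 1" for x
  proof -
    \<comment> \<open>The 3 ensures \<open>2 * ?e n < x\<close> already for n = 0, so that the
      interval cut off by \<open>?e n\<close> on both sides is never empty and stays inside (0,
      1).\<close>
    let ?e = "\<lambda>n. x * (1 / real (n + 3))"
    have lim: "?e \<longlonglongrightarrow> x * 0"
      by (intro tendsto_mult_left) (rule LIMSEQ_ignore_initial_segment[OF lim_1_over_n])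
    have "(\<lambda>n. \<integral>y. w y * indicator {?e n<..<x - ?e n} y \<partial>M01) \<longlonglongrightarrow> (\<integral>y. w y * indicator {..x} y \<partial>M01)"
    proof (rule dom)
      show "AE y in M01. (\<lambda>n. indicator {?e n<..<x - ?e n} y) \<longlonglongrightarrow> (indicator {..x} y :: real)"
        using AE_M01_neq[of x] AE_M01_neq[of 0] AE_space
      proof eventually_elim
        case (elim y)
        then have y: "0 < y" "y \<noteq> x" by auto
        show ?case
        proof (cases "y < x")
          case True
          have "\<forall>\<^sub>F n in sequentially. ?e n < y" "\<forall>\<^sub>F n in sequentially. ?e n < x - y"
            using lim True y by (auto intro: order_tendstoD)
          then have "\<forall>\<^sub>F n in sequentially. indicator {?e n<..<x - ?e n} y = (indicator {..x} y :: real)"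
            by eventually_elim (use True in auto)
          then show ?thesis by (rule tendsto_eventually)
        next
          case False
          have "y \<notin> {?e n<..<x - ?e n}" for n
          proof -
            have "0 \<le> ?e n" using x by simp
            with False show ?thesis unfolding greaterThanLessThan_iff by linarith
          qed
          then have "indicator {?e n<..<x - ?e n} y = (indicator {..x} y :: real)" for n
            using False y by (subst indicator_simps(2)) auto
          then show ?thesis by simp
        qed
      qed
    qed (auto simp: indicator_def)
    moreover have "(\<integral>y. w y * indicator {?e n<..<x - ?e n} y \<partial>M01) = 0" for n
    proof (rule open_interval)
      show "0 < ?e n" using x by simp
      have "2 * ?e n < x" using x by (simp add: field_simps add_pos_nonneg)
      then show "?e n < x - ?e n" by simp
      show "x - ?e n < 1" using x \<open>0 < ?e n\<close> by linarith
    qed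
    ultimately show ?thesis by (simp add: prim_def LIMSEQ_const_iff)
  qed
  fix x :: real
  consider "x \<le> 0" | "0 < x" "x \<le> 1" | "x > 1" by linarith
  then show "prim w x = 0"
  proof cases
    case 1
    have "prim w x = (\<integral>y. 0 \<partial>M01)"
      unfolding prim_def using AE_M01_neq[of 0] AE_space
      by (intro integral_cong_AE) (use w 1 in \<open>auto simp: indicator_def elim!: eventually_elim2\<close>)
    then show ?thesis by simp
  next
    case 3
    then have "prim w x = prim w 1"
      unfolding prim_def by (intro Bochner_Integration.integral_cong) (auto simp: indicator_def)
    with mid[of 1] show ?thesis by simp
  qed (rule mid)
qed

section \<open>Weak derivatives and traces\<close>

lemma prim_eq_integral:
  assumes "integrable M01 g" "x \<in> {0..1}"
  shows "prim g x = integral {0..x} g"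
proof -
  have "prim g x = integral {0..1} (\<lambda>y. g y * indicator {..x} y)"
    unfolding prim_def by (rule lebesgue_integral_eq_integral[OF integrable_M01_indicator]) (use assms in auto)
  also have "(\<lambda>y. g y * indicator {..x} y) = (\<lambda>y. if y \<in> {..x} then g y else 0)"
    by (auto simp: indicator_def)
  also have "integral {0..1} \<dots> = integral ({..x} \<inter> {0..1}) g"
    by (rule Henstock_Kurzweil_Integration.integral_restrict_Int)
  also have "{..x} \<inter> {0..1} = {0..x}" using assms(2) by auto
  finally show ?thesis .
qed

lemma prim_continuous_on: "integrable M01 g \<Longrightarrow> continuous_on {0..1} (prim g)"
  using indefinite_integral_continuous_1[OF integrable_on_lebesgue_on[of "{0..1}" g]]
  by (subst continuous_on_cong[OF refl prim_eq_integral]) auto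

lemma prim_0: "integrable M01 g \<Longrightarrow> prim g 0 = 0"
  by (simp add: prim_eq_integral)

lemma prim_1: "prim g 1 = integral\<^sup>L M01 g"
  unfolding prim_def by (rule Bochner_Integration.integral_cong) auto

lemma prim_measurable [measurable]: "integrable M01 g \<Longrightarrow> prim g \<in> borel_measurable M01"
  by (meson borel_measurable_integrable continuous_imp_integrable_real prim_continuous_on)

lemma integrable_M01_abs_le:
  "integrable M01 g \<Longrightarrow> A \<in> sets borel \<Longrightarrow>
    \<bar>\<integral>y. g y * indicator A y \<partial>M01\<bar> \<le> (\<integral>y. \<bar>g y\<bar> \<partial>M01)" for g :: "real \<Rightarrow> real"
  by (rule order_trans[OF integral_abs_bound])
     (intro integral_mono integrable_abs integrable_M01_indicator, auto simp: indicator_def)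

lemma prim_abs_le: "integrable M01 g \<Longrightarrow> \<bar>prim g x\<bar> \<le> (\<integral>y. \<bar>g y\<bar> \<partial>M01)"
  unfolding prim_def by (rule integrable_M01_abs_le) auto

lemma prim_diff_abs_le:
  assumes "integrable M01 g"
  shows "\<bar>prim g x - prim g y\<bar> \<le> (\<integral>y. \<bar>g y\<bar> \<partial>M01)"
proof (induction x y rule: linorder_wlog)
  case (le x y)
  have "prim g y - prim g x = (\<integral>z. g z * indicator {..y} z - g z * indicator {..x} z \<partial>M01)"
    unfolding prim_def using assms by (simp add: integrable_M01_indicator)
  also have "\<dots> = (\<integral>z. g z * indicator {x<..y} z \<partial>M01)"
    by (rule Bochner_Integration.integral_cong) (use le in \<open>auto simp: indicator_def\<close>)
  finally show ?case using integrable_M01_abs_le[OF assms, of "{x<..y}"] by simp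
qed (simp add: abs_minus_commute)

lemma prim_add: "integrable M01 f \<Longrightarrow> integrable M01 g \<Longrightarrow> prim (\<lambda>x. f x + g x) x = prim f x + prim g x"
  by (simp add: prim_def distrib_right integrable_M01_indicator)

lemma prim_mult: "prim (\<lambda>x. c * f x) x = c * prim f x"
  by (simp add: prim_def mult.assoc)

lemma prim_cong_AE:
  assumes "f \<in> borel_measurable M01" "g \<in> borel_measurable M01" "AE x in M01. f x = g x"
  shows "prim f x = prim g x"
  unfolding prim_def by (rule integral_cong_AE) (use assms in auto)

lemma integrable_mult_prim:
  "integrable M01 f \<Longrightarrow> integrable M01 g \<Longrightarrow> integrable M01 (\<lambda>x. f x * prim g x)"
  by (rule integrable_M01_mult_bounded[where B = "\<integral>y. \<bar>g y\<bar> \<partial>M01"])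
     (auto simp: prim_abs_le)

text \<open>Fubini on the triangle y \<le> x: integrating f x * g y first over x leaves
  \<open>prim f 1 - prim f y\<close>. Mere integrability of both functions suffices.\<close>

lemma prim_by_parts:
  assumes f: "integrable M01 f" and g: "integrable M01 g"
  shows "(\<integral>x. f x * prim g x \<partial>M01) + (\<integral>x. g x * prim f x \<partial>M01) = prim f 1 * prim g 1"
proof -
  interpret P: pair_sigma_finite M01 M01 ..
  have [measurable]: "f \<in> borel_measurable M01" "g \<in> borel_measurable M01"
    using f g by auto
  have [measurable]: "(\<lambda>x. x) \<in> borel_measurable M01" by (rule borel_measurable_M01) simp
  have fg: "integrable (M01 \<Otimes>\<^sub>M M01) (\<lambda>(x, y). f x * g y)"
    by (rule P.Fubini_integrable) (use f g in \<open>auto simp: abs_mult\<close>)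
  have "integrable (M01 \<Otimes>\<^sub>M M01) (\<lambda>(x, y). f x * (g y * indicator {..x} y))"
  proof (rule Bochner_Integration.integrable_bound[OF fg])
    have "(\<lambda>(x, y). f x * (if y \<le> x then g y else 0)) \<in> borel_measurable (M01 \<Otimes>\<^sub>M M01)"
      by measurable
    moreover have "(\<lambda>(x, y). f x * (g y * indicator {..x} y)) = (\<lambda>(x, y). f x * (if y \<le> x then g y else 0))"
      by (auto simp: indicator_def)
    ultimately show "(\<lambda>(x, y). f x * (g y * indicator {..x} y)) \<in> borel_measurable (M01 \<Otimes>\<^sub>M M01)"
      by simp
  qed (auto simp: indicator_def)
  from P.Fubini_integral[OF this]
  have "(\<integral>x. f x * prim g x \<partial>M01) = (\<integral>y. (\<integral>x. f x * (g y * indicator {..x} y) \<partial>M01) \<partial>M01)"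
    by (simp add: prim_def)
  also have "\<dots> = (\<integral>y. g y * (prim f 1 - prim f y) \<partial>M01)"
  proof (rule Bochner_Integration.integral_cong[OF refl])
    fix y
    \<comment> \<open>Both sides restrict to x above y; they differ only at the single point x =
      y.\<close>
    have "AE x in M01. f x * (g y * indicator {..x} y) = g y * (f x - f x * indicator {..y} x)"
      using AE_M01_neq[of y] by eventually_elim (auto simp: indicator_def)
    then have "(\<integral>x. f x * (g y * indicator {..x} y) \<partial>M01) = (\<integral>x. g y * (f x - f x * indicator {..y} x) \<partial>M01)"
    proof (rule integral_cong_AE[rotated 2])
      have "(\<lambda>x. f x * (if y \<le> x then g y else 0)) \<in> borel_measurable M01" by measurable
      then show "(\<lambda>x. f x * (g y * indicator {..x} y)) \<in> borel_measurable M01"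
        by (rule arg_cong[where f = "\<lambda>h. h \<in> borel_measurable M01", THEN iffD1, rotated]) (auto simp: indicator_def)
    qed measurable
    also have "\<dots> = g y * (prim f 1 - prim f y)"
      using f by (simp add: prim_1 integrable_M01_indicator) (simp add: prim_def)
    finally show "(\<integral>x. f x * (g y * indicator {..x} y) \<partial>M01) = g y * (prim f 1 - prim f y)" .
  qed
  also have "\<dots> = prim f 1 * prim g 1 - (\<integral>y. g y * prim f y \<partial>M01)"
    using f g by (simp add: right_diff_distrib integrable_mult_prim prim_1)
  finally show ?thesis by simp
qed

lemma test_fun_eq_prim:
  assumes "test_fun \<phi>" "x \<in> {0..1}"
  shows "\<phi> x = prim (deriv \<phi>) x"
proof -
  have "(deriv \<phi> has_integral (\<phi> x - \<phi> 0)) {0..x}"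
    using assms by (intro fundamental_theorem_of_calculus)
      (auto simp flip: has_real_derivative_iff_has_vector_derivative
        intro: has_field_derivative_at_within test_fun_has_derivative)
  moreover have "\<phi> 0 = 0" using assms(1) by (force simp: test_fun_def)
  moreover have "integrable M01 (deriv \<phi>)"
    by (intro integrable_M01_continuous test_fun_deriv_continuous_on assms(1))
  ultimately show ?thesis using assms(2) by (simp add: prim_eq_integral integral_unique)
qed

lemma test_fun_1: "test_fun \<phi> \<Longrightarrow> \<phi> 1 = 0"
  by (force simp: test_fun_def)

lemma test_fun_integrable_mult:
  assumes "integrable M01 w" "test_fun \<phi>"
  shows "integrable M01 (\<lambda>x. w x * \<phi> x)" "integrable M01 (\<lambda>x. w x * deriv \<phi> x)"
proof -
  have *: "integrable M01 (\<lambda>x. w x * g x)" if "continuous_on {0..1} g" for g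
  proof -
    have "bounded (g ` {0..1})" using that by (intro compact_imp_bounded compact_continuous_image) auto
    then obtain B where "\<And>x. x \<in> {0..1} \<Longrightarrow> \<bar>g x\<bar> \<le> B" by (force simp: bounded_iff)
    then show ?thesis
      using assms(1) that
      by (auto intro!: integrable_M01_mult_bounded[where B = B] AE_M01I
          borel_measurable_integrable[OF integrable_M01_continuous])
  qed
  show "integrable M01 (\<lambda>x. w x * \<phi> x)" "integrable M01 (\<lambda>x. w x * deriv \<phi> x)"
    by (rule *; intro test_fun_continuous_on test_fun_deriv_continuous_on assms(2))+
qed

lemma weak_deriv_prim:
  assumes g: "integrable M01 g"
  shows "weak_deriv (prim g) g"
  unfolding weak_deriv_def
proof (intro conjI allI impI g)
  show "integrable M01 (prim g)" by (intro integrable_M01_continuous prim_continuous_on g)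
  fix \<phi> assume \<phi>: "test_fun \<phi>"
  have d: "integrable M01 (deriv \<phi>)"
    by (intro integrable_M01_continuous test_fun_deriv_continuous_on \<phi>)
  have "(\<integral>x. g x * \<phi> x \<partial>M01) = (\<integral>x. g x * prim (deriv \<phi>) x \<partial>M01)"
    by (rule Bochner_Integration.integral_cong) (auto simp: test_fun_eq_prim[OF \<phi>])
  moreover have "prim (deriv \<phi>) 1 = 0"
    using test_fun_eq_prim[OF \<phi>, of 1] test_fun_1[OF \<phi>] by simp
  ultimately show "(\<integral>x. prim g x * deriv \<phi> x \<partial>M01) = - (\<integral>x. g x * \<phi> x \<partial>M01)"
    using prim_by_parts[OF d g] by (simp add: mult.commute)
qed

text \<open>The lemma of du Bois-Reymond. Subtracting from a test function the right multiple of one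
  fixed bump of nonzero mean leaves a function of zero mean, which is the derivative of a test
  function and hence orthogonal to \<open>u\<close>.\<close>

lemma weak_deriv_0_imp_const:
  assumes "weak_deriv u (\<lambda>_. 0)"
  shows "\<exists>c. AE x in M01. u x = c"
proof -
  have u: "integrable M01 u" and orth: "\<And>\<phi>. test_fun \<phi> \<Longrightarrow> (\<integral>x. u x * deriv \<phi> x \<partial>M01) = 0"
    using assms by (auto simp: weak_deriv_def)
  define \<psi> where "\<psi> = bump (1/4) (3/4) 1"
  have \<psi>: "test_fun \<psi>" unfolding \<psi>_def by (rule test_fun_bump) auto
  have \<psi>_int: "\<psi> integrable_on {0..1}" by (intro integrable_continuous_real test_fun_continuous_on \<psi>)
  have "integral {0..1} \<psi> \<noteq> 0"
  proof
    assume "integral {0..1} \<psi> = 0"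
    then have "\<psi> (1/2) = 0"
      by (subst (asm) integral_eq_0_iff) (auto simp: \<psi>_def bump_nonneg intro!: test_fun_continuous_on test_fun_bump)
    then show False by (simp add: \<psi>_def bump_def flat_def)
  qed
  \<comment> \<open>The only constant for which \<open>u - c\<close> can be orthogonal to
    \<open>\<psi>\<close>.\<close>
  define c where "c = (\<integral>x. u x * \<psi> x \<partial>M01) / integral {0..1} \<psi>"
  have "(\<integral>x. (u x - c) * \<phi> x \<partial>M01) = 0" if \<phi>: "test_fun \<phi>" for \<phi>
  proof -
    \<comment> \<open>Chosen to make the mean of \<open>\<zeta>\<close> zero.\<close>
    define r where "r = integral {0..1} \<phi> / integral {0..1} \<psi>"
    define \<zeta> where "\<zeta> x = \<phi> x - r * \<psi> x" for x
    have \<phi>_int: "\<phi> integrable_on {0..1}" by (intro integrable_continuous_real test_fun_continuous_on \<phi>)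
    have higher: "(deriv ^^ k) \<zeta> = (\<lambda>x. (deriv ^^ k) \<phi> x - r * (deriv ^^ k) \<psi> x)" for k
    proof (induction k)
      case (Suc k)
      have "deriv (\<lambda>x. (deriv ^^ k) \<phi> x - r * (deriv ^^ k) \<psi> x) x
          = deriv ((deriv ^^ k) \<phi>) x - r * deriv ((deriv ^^ k) \<psi>) x" for x
        using \<phi> \<psi> unfolding test_fun_def
        by (intro DERIV_imp_deriv DERIV_diff DERIV_cmult) (auto simp: DERIV_deriv_iff_real_differentiable)
      with Suc show ?case by auto
    qed (auto simp: \<zeta>_def)
    obtain a b where ab: "0 < a" "a \<le> b" "b < 1" "\<And>x. x \<notin> {a..b} \<Longrightarrow> \<phi> x = 0"
      using \<phi> by (auto simp: test_fun_def)
    obtain a' b' where ab': "0 < a'" "a' \<le> b'" "b' < 1" "\<And>x. x \<notin> {a'..b'} \<Longrightarrow> \<psi> x = 0"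
      using \<psi> by (auto simp: test_fun_def)
    obtain \<Phi> where \<Phi>: "test_fun \<Phi>" "deriv \<Phi> = \<zeta>"
    proof (rule test_fun_primitive)
      show "(deriv ^^ k) \<zeta> differentiable (at x)" for k x
        unfolding higher using \<phi> \<psi> by (auto simp: test_fun_def intro!: derivative_intros)
      show "0 < min a a'" "min a a' \<le> max b b'" "max b b' < 1" using ab ab' by auto
      show "\<zeta> x = 0" if "x \<notin> {min a a'..max b b'}" for x
      proof -
        from that have "x \<notin> {a..b}" "x \<notin> {a'..b'}" by auto
        then show ?thesis by (simp add: \<zeta>_def ab(4) ab'(4))
      qed
      show "integral {0..1} \<zeta> = 0"
        unfolding \<zeta>_def
        using \<open>integral {0..1} \<psi> \<noteq> 0\<close> \<phi>_int integrable_on_mult_right[OF \<psi>_int, of r]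
        by (subst Henstock_Kurzweil_Integration.integral_diff) (simp_all add: r_def)
    qed auto
    have "(\<integral>x. u x * \<phi> x \<partial>M01) - r * (\<integral>x. u x * \<psi> x \<partial>M01) = (\<integral>x. u x * \<zeta> x \<partial>M01)"
      using u \<phi> \<psi> by (simp add: \<zeta>_def right_diff_distrib test_fun_integrable_mult mult.left_commute)
    also have "\<dots> = 0" using orth[OF \<Phi>(1)] \<Phi>(2) by simp
    finally have "(\<integral>x. u x * \<phi> x \<partial>M01) = c * integral {0..1} \<phi>"
      by (simp add: r_def c_def)
    also have "integral {0..1} \<phi> = integral\<^sup>L M01 \<phi>"
      by (rule lebesgue_integral_eq_integral[symmetric])
         (auto intro!: integrable_M01_continuous test_fun_continuous_on \<phi>)
    finally show ?thesis
      using u \<phi> by (simp add: left_diff_distrib test_fun_integrable_mult integrable_M01_continuous test_fun_continuous_on)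
  qed
  then have "AE x in M01. u x - c = 0"
    by (rule AE_0_if_orthogonal_test_fun[rotated]) (use u in auto)
  then show ?thesis by (intro exI[of _ c]) auto
qed

lemma weak_deriv_lin:
  assumes "weak_deriv f g" "weak_deriv f' g'"
  shows "weak_deriv (\<lambda>x. a * f x + b * f' x) (\<lambda>x. a * g x + b * g' x)"
  using assms
  by (auto simp: weak_deriv_def distrib_right mult.assoc test_fun_integrable_mult)

lemma weak_deriv_diff:
  assumes "weak_deriv f g" "weak_deriv f' g'"
  shows "weak_deriv (\<lambda>x. f x - f' x) (\<lambda>x. g x - g' x)"
  using weak_deriv_lin[OF assms, of 1 "-1"] by simp

text \<open>The difference \<open>f - prim g\<close> has weak derivative 0. This provides the
  absolutely continuous representative from which boundary values and integration by parts are
  obtained.\<close>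

lemma weak_deriv_imp_prim:
  assumes "weak_deriv f g"
  obtains c where "AE x in M01. f x = c + prim g x"
proof -
  have g: "integrable M01 g" using assms by (simp add: weak_deriv_def)
  have "weak_deriv (\<lambda>x. f x - prim g x) (\<lambda>x. g x - g x)"
    by (intro weak_deriv_diff assms weak_deriv_prim g)
  then obtain c where "AE x in M01. f x - prim g x = c"
    using weak_deriv_0_imp_const by auto
  then have "AE x in M01. f x = c + prim g x" by eventually_elim simp
  then show ?thesis by (rule that)
qed

lemma weak_deriv_unique:
  assumes f: "weak_deriv f g" and f': "weak_deriv f' g'" and eq: "AE x in M01. f x = f' x"
  shows "AE x in M01. g x = g' x"
proof -
  have int: "integrable M01 f" "integrable M01 f'" "integrable M01 g" "integrable M01 g'"
    using f f' by (auto simp: weak_deriv_def)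
  have "AE x in M01. g x - g' x = 0"
  proof (rule AE_0_if_orthogonal_test_fun)
    show "integrable M01 (\<lambda>x. g x - g' x)" using int by simp
    fix \<phi> assume \<phi>: "test_fun \<phi>"
    have "(\<integral>x. f x * deriv \<phi> x \<partial>M01) = (\<integral>x. f' x * deriv \<phi> x \<partial>M01)"
      using eq int \<phi> by (intro integral_cong_AE) (auto intro!: borel_measurable_integrable test_fun_integrable_mult)
    then show "(\<integral>x. (g x - g' x) * \<phi> x \<partial>M01) = 0"
      using f f' \<phi> int by (simp add: weak_deriv_def left_diff_distrib test_fun_integrable_mult)
  qed
  then show ?thesis by eventually_elim simp
qed

text \<open>A continuous nonnegative function with zero integral vanishes. This makes the continuous
  representative unique and so the description in \<open>bval\<close> well defined.\<close>

lemma continuous_AE_eq_imp_eq: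
  assumes "continuous_on {0..1} g" "continuous_on {0..1} h" "AE x in M01. g x = h x" "a \<in> {0..1}"
  shows "g a = (h a :: real)"
proof -
  let ?D = "\<lambda>x. \<bar>g x - h x\<bar>"
  have c: "continuous_on {0..1} ?D" using assms by (intro continuous_intros)
  have "integral {0..1} ?D = integral\<^sup>L M01 ?D"
    by (rule lebesgue_integral_eq_integral[symmetric]) (auto intro: integrable_M01_continuous c)
  also have "\<dots> = 0"
    by (rule integral_eq_zero_AE) (use assms(3) in auto)
  finally show ?thesis
    using integral_eq_0_iff[OF c] assms(4) by auto
qed

lemma bval_eq:
  assumes "continuous_on {0..1} g" "AE x in M01. f x = g x" "a \<in> {0..1}"
  shows "bval f a = g a"
  unfolding bval_def
proof (rule the_equality)
  show "\<exists>h. continuous_on {0..1} h \<and> (AE x in M01. f x = h x) \<and> h a = g a"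
    using assms by blast
  fix c assume "\<exists>h. continuous_on {0..1} h \<and> (AE x in M01. f x = h x) \<and> h a = c"
  then obtain h where h: "continuous_on {0..1} h" "AE x in M01. f x = h x" "h a = c" by blast
  from h(2) assms(2) have "AE x in M01. h x = g x" by eventually_elim simp
  from continuous_AE_eq_imp_eq[OF h(1) assms(1) this assms(3)] h(3) show "c = g a" by simp
qed

lemma weak_deriv_imp_bval_prim:
  assumes "weak_deriv f g"
  shows "AE x in M01. f x = bval f 0 + prim g x" and "bval f 1 = bval f 0 + prim g 1"
proof -
  have g: "integrable M01 g" using assms by (simp add: weak_deriv_def)
  obtain c where c: "AE x in M01. f x = c + prim g x" using assms by (rule weak_deriv_imp_prim)
  have "continuous_on {0..1} (\<lambda>x. c + prim g x)" by (intro continuous_intros prim_continuous_on g)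
  from bval_eq[OF this c, of 0] bval_eq[OF this c, of 1] g
  have "bval f 0 = c" "bval f 1 = c + prim g 1" by (auto simp: prim_0)
  with c show "AE x in M01. f x = bval f 0 + prim g x" "bval f 1 = bval f 0 + prim g 1" by auto
qed

lemma bval_diff:
  assumes f: "weak_deriv f g" and f': "weak_deriv f' g'" and a: "a \<in> {0..1}"
  shows "bval (\<lambda>x. f x - f' x) a = bval f a - bval f' a"
proof -
  have g: "integrable M01 g" "integrable M01 g'" using f f' by (auto simp: weak_deriv_def)
  obtain c c' where c: "AE x in M01. f x = c + prim g x" "AE x in M01. f' x = c' + prim g' x"
    using weak_deriv_imp_prim f f' by metis
  then have ae: "AE x in M01. f x - f' x = (c + prim g x) - (c' + prim g' x)" by eventually_elim simp
  have co: "continuous_on {0..1} (\<lambda>x. c + prim g x)" "continuous_on {0..1} (\<lambda>x. c' + prim g' x)"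
    by (intro continuous_intros prim_continuous_on g)+
  show ?thesis
    using bval_eq[OF continuous_on_diff[OF co] ae a] bval_eq[OF co(1) c(1) a] bval_eq[OF co(2) c(2) a] by simp
qed

text \<open>Zero boundary values of \<open>f\<close> alone remove both boundary terms: then
  \<open>f\<close> is \<open>prim g\<close> almost everywhere with \<open>prim g 1 = 0\<close>, and
  the unknown constant in \<open>f'\<close> is multiplied by that 0.\<close>

lemma weak_deriv_by_parts:
  assumes f: "weak_deriv f g" "bval f 0 = 0" "bval f 1 = 0" and f': "weak_deriv f' g'"
  shows "(\<integral>x. g x * f' x \<partial>M01) = - (\<integral>x. g' x * f x \<partial>M01)"
proof -
  have g: "integrable M01 g" "integrable M01 g'" "integrable M01 f" "integrable M01 f'"
    using f f' by (auto simp: weak_deriv_def)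
  have fp: "AE x in M01. f x = prim g x" and g1: "prim g 1 = 0"
    using weak_deriv_imp_bval_prim[OF f(1)] f(2,3) by auto
  obtain c where c: "AE x in M01. f' x = c + prim g' x" using f' by (rule weak_deriv_imp_prim)
  have "(\<integral>x. g x * f' x \<partial>M01) = (\<integral>x. c * g x + g x * prim g' x \<partial>M01)"
    using c by (intro integral_cong_AE) (use g in \<open>auto elim!: eventually_mono simp: algebra_simps\<close>)
  also have "\<dots> = (\<integral>x. g x * prim g' x \<partial>M01)"
    using g g1 by (simp add: integrable_mult_prim prim_1)
  also have "\<dots> = - (\<integral>x. g' x * prim g x \<partial>M01)"
    using prim_by_parts[OF g(1,2)] g1 by simp
  also have "(\<integral>x. g' x * prim g x \<partial>M01) = (\<integral>x. g' x * f x \<partial>M01)"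
    using fp by (intro integral_cong_AE) (use g in auto)
  finally show ?thesis .
qed

section \<open>The space of square integrable functions\<close>

definition ip :: "(real \<Rightarrow> real) \<Rightarrow> (real \<Rightarrow> real) \<Rightarrow> real" where
  "ip f g = (\<integral>x. f x * g x \<partial>M01)"

lemma ip_commute: "ip f g = ip g f"
  by (simp add: ip_def mult.commute)

lemma L2_measurable: "f \<in> L2 \<Longrightarrow> f \<in> borel_measurable M01"
  by (simp add: L2_def)

lemma L2_mult_integrable:
  assumes "f \<in> L2" "g \<in> L2"
  shows "integrable M01 (\<lambda>x. f x * g x)"
proof (rule Bochner_Integration.integrable_bound)
  show "integrable M01 (\<lambda>x. (f x)\<^sup>2 + (g x)\<^sup>2)" using assms by (simp add: L2_def)
  show "(\<lambda>x. f x * g x) \<in> borel_measurable M01" using assms by (auto simp: L2_def)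
  have "\<bar>a * b\<bar> \<le> a\<^sup>2 + b\<^sup>2" for a b :: real
    using sum_squares_bound[of "\<bar>a\<bar>" "\<bar>b\<bar>"] abs_ge_zero[of "a * b"]
    unfolding abs_mult power2_abs by linarith
  then show "AE x in M01. norm (f x * g x) \<le> norm ((f x)\<^sup>2 + (g x)\<^sup>2)" by simp
qed

lemma L2_lin:
  assumes "f \<in> L2" "g \<in> L2"
  shows "(\<lambda>x. a * f x + b * g x) \<in> L2"
proof -
  have "integrable M01 (\<lambda>x. a\<^sup>2 * (f x)\<^sup>2 + 2 * a * b * (f x * g x) + b\<^sup>2 * (g x)\<^sup>2)"
    using L2_mult_integrable[OF assms] assms by (simp add: L2_def)
  moreover have "(\<lambda>x. (a * f x + b * g x)\<^sup>2) = (\<lambda>x. a\<^sup>2 * (f x)\<^sup>2 + 2 * a * b * (f x * g x) + b\<^sup>2 * (g x)\<^sup>2)"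
    by (auto simp: power2_eq_square algebra_simps)
  ultimately show ?thesis using assms by (auto simp: L2_def)
qed

lemma L2_diff: "f \<in> L2 \<Longrightarrow> g \<in> L2 \<Longrightarrow> (\<lambda>x. f x - g x) \<in> L2"
  using L2_lin[of f g 1 "-1"] by simp

lemma L2_cmult: "f \<in> L2 \<Longrightarrow> (\<lambda>x. c * f x) \<in> L2"
  using L2_lin[of f f c 0] by simp

lemma L2_difference_quotient:
  "f \<in> L2 \<Longrightarrow> g \<in> L2 \<Longrightarrow> (\<lambda>x. (f x - g x) / c) \<in> L2"
  using L2_cmult[OF L2_diff, of f g "1 / c"] by simp

lemma L2_bounded:
  assumes "f \<in> borel_measurable M01" "AE x in M01. \<bar>f x\<bar> \<le> B"
  shows "f \<in> L2"
proof -
  have "integrable M01 (\<lambda>x. (f x)\<^sup>2)"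
  proof (rule M01.integrable_const_bound[where B = "B\<^sup>2"])
    show "AE x in M01. norm ((f x)\<^sup>2) \<le> B\<^sup>2"
      using assms(2) by eventually_elim (simp add: abs_le_square_iff[symmetric] abs_le_iff)
  qed (use assms in measurable)
  with assms show ?thesis by (simp add: L2_def)
qed

lemma L2_const: "(\<lambda>_. c) \<in> L2"
  by (rule L2_bounded[where B = "\<bar>c\<bar>"]) auto

lemma L2_integrable: "f \<in> L2 \<Longrightarrow> integrable M01 f"
  using L2_mult_integrable[OF _ L2_const[of 1]] by simp

lemma L2_cong_AE:
  assumes "f \<in> L2" "AE x in M01. f x = g x" "g \<in> borel_measurable M01"
  shows "g \<in> L2"
proof -
  have "integrable M01 (\<lambda>x. (f x)\<^sup>2) \<longleftrightarrow> integrable M01 (\<lambda>x. (g x)\<^sup>2)"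
    by (rule integrable_cong_AE) (use assms L2_measurable in \<open>auto elim!: eventually_mono\<close>)
  with assms show ?thesis by (simp add: L2_def)
qed

lemma L2norm_nonneg [simp]: "0 \<le> L2norm f"
  by (simp add: L2norm_def)

lemma L2norm_power2: "(L2norm f)\<^sup>2 = ip f f"
  by (simp add: L2norm_def ip_def power2_eq_square[symmetric])

lemma L2norm_cong_AE:
  assumes "f \<in> borel_measurable M01" "g \<in> borel_measurable M01" "AE x in M01. f x = g x"
  shows "L2norm f = L2norm g"
proof -
  have "(\<integral>x. (f x)\<^sup>2 \<partial>M01) = (\<integral>x. (g x)\<^sup>2 \<partial>M01)"
    using assms by (intro integral_cong_AE) (auto elim!: eventually_mono)
  then show ?thesis by (simp add: L2norm_def)
qed

lemma L2norm_cmult: "L2norm (\<lambda>x. c * f x) = \<bar>c\<bar> * L2norm f"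
  by (simp add: L2norm_def power_mult_distrib real_sqrt_mult)

lemma L2norm_minus_commute: "L2norm (\<lambda>x. f x - g x) = L2norm (\<lambda>x. g x - f x)"
  by (simp add: L2norm_def power2_commute)

lemma ip_lin_left:
  assumes "f \<in> L2" "g \<in> L2" "h \<in> L2"
  shows "ip (\<lambda>x. a * f x + b * g x) h = a * ip f h + b * ip g h"
  using assms by (simp add: ip_def distrib_right mult.assoc L2_mult_integrable)

lemma ip_cong_AE:
  assumes "f \<in> borel_measurable M01" "g \<in> borel_measurable M01" "h \<in> borel_measurable M01"
    "AE x in M01. f x = g x"
  shows "ip f h = ip g h"
  unfolding ip_def using assms by (intro integral_cong_AE) auto

text \<open>Nonnegativity of the quadratic form in a and b. On representatives \<open>ip\<close> is
  only semidefinite, so the case \<open>ip g g = 0\<close> does not mean that \<open>g\<close> is 0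
  and is treated separately.\<close>

lemma ip_Cauchy_Schwarz:
  assumes "f \<in> L2" "g \<in> L2"
  shows "\<bar>ip f g\<bar> \<le> L2norm f * L2norm g"
proof -
  have quad: "0 \<le> a\<^sup>2 * ip f f + 2 * a * b * ip f g + b\<^sup>2 * ip g g" for a b
  proof -
    have "0 \<le> ip (\<lambda>x. a * f x + b * g x) (\<lambda>x. a * f x + b * g x)"
      by (simp add: L2norm_power2[symmetric])
    also have "\<dots> = a * ip f (\<lambda>x. a * f x + b * g x) + b * ip g (\<lambda>x. a * f x + b * g x)"
      by (intro ip_lin_left L2_lin assms)
    also have "\<dots> = a\<^sup>2 * ip f f + 2 * a * b * ip f g + b\<^sup>2 * ip g g"
      unfolding ip_commute[of f "\<lambda>x. a * f x + b * g x"] ip_commute[of g "\<lambda>x. a * f x + b * g x"]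
      using assms by (simp add: ip_lin_left ip_commute[of g f] algebra_simps power2_eq_square)
    finally show ?thesis .
  qed
  have "(ip f g)\<^sup>2 \<le> ip f f * ip g g"
  proof (cases "ip g g = 0")
    case True
    have "ip f g = 0"
    proof (rule ccontr)
      assume n: "ip f g \<noteq> 0"
      \<comment> \<open>With \<open>ip g g = 0\<close> the form is affine in b; this b gives it the
        value -1.\<close>
      have "0 \<le> ip f f + 2 * (- (ip f f + 1) / (2 * ip f g)) * ip f g"
        using quad[of 1 "- (ip f f + 1) / (2 * ip f g)"] True by simp
      also have "\<dots> = -1" using n by (simp add: field_simps)
      finally show False by simp
    qed
    then show ?thesis using True by simp
  next
    case False
    then have pos: "ip g g > 0" by (metis L2norm_power2 zero_le_power2 less_eq_real_def)
    have "0 \<le> ip g g * (ip f f * ip g g - (ip f g)\<^sup>2)"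
      using quad[of "ip g g" "- ip f g"] by (simp add: algebra_simps power2_eq_square)
    with pos show ?thesis by (simp add: zero_le_mult_iff)
  qed
  then have "\<bar>ip f g\<bar>\<^sup>2 \<le> (L2norm f * L2norm g)\<^sup>2"
    by (simp add: power_mult_distrib L2norm_power2)
  then show ?thesis by (rule power2_le_imp_le) simp
qed

lemma L2norm_triangle:
  assumes "f \<in> L2" "g \<in> L2"
  shows "L2norm (\<lambda>x. f x + g x) \<le> L2norm f + L2norm g"
proof (rule power2_le_imp_le)
  have "(L2norm (\<lambda>x. f x + g x))\<^sup>2 = ip f f + 2 * ip f g + ip g g"
  proof -
    have "(\<lambda>x. (f x + g x) * (f x + g x)) = (\<lambda>x. f x * f x + 2 * (f x * g x) + g x * g x)"
      by (auto simp: algebra_simps)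
    then show ?thesis
      using assms by (simp add: L2norm_power2 ip_def L2_mult_integrable)
  qed
  also have "\<dots> \<le> (L2norm f)\<^sup>2 + 2 * (L2norm f * L2norm g) + (L2norm g)\<^sup>2"
    using ip_Cauchy_Schwarz[OF assms] by (simp add: L2norm_power2)
  finally show "(L2norm (\<lambda>x. f x + g x))\<^sup>2 \<le> (L2norm f + L2norm g)\<^sup>2"
    by (simp add: power2_sum algebra_simps)
qed simp

lemma L2norm_triangle_diff:
  assumes "f \<in> L2" "g \<in> L2"
  shows "L2norm (\<lambda>x. f x - g x) \<le> L2norm f + L2norm g"
  using L2norm_triangle[OF assms(1) L2_cmult[OF assms(2), of "-1"]] L2norm_cmult[of "-1" g] by simp

lemma L2norm_le_diff:
  assumes "f \<in> L2" "g \<in> L2"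
  shows "L2norm f \<le> L2norm g + L2norm (\<lambda>x. f x - g x)"
  using L2norm_triangle[OF assms(2) L2_diff[OF assms]] by simp

lemma L2norm_abs_diff_le:
  assumes "f \<in> L2" "g \<in> L2"
  shows "\<bar>L2norm f - L2norm g\<bar> \<le> L2norm (\<lambda>x. f x - g x)"
  using L2norm_le_diff[OF assms] L2norm_le_diff[OF assms(2,1)] L2norm_minus_commute[of f g] by linarith

lemma L2norm_const [simp]: "L2norm (\<lambda>_. c) = \<bar>c\<bar>"
  by (simp add: L2norm_def)

lemma L2norm_mono_AE:
  assumes "f \<in> borel_measurable M01" "g \<in> L2" "AE x in M01. \<bar>f x\<bar> \<le> \<bar>g x\<bar>"
  shows "L2norm f \<le> L2norm g"
  unfolding L2norm_def
proof (intro real_sqrt_le_mono integral_mono_AE)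
  show g: "integrable M01 (\<lambda>x. (g x)\<^sup>2)" using assms by (simp add: L2_def)
  show le: "AE x in M01. (f x)\<^sup>2 \<le> (g x)\<^sup>2"
    using assms(3) by eventually_elim (simp add: abs_le_square_iff)
  show "integrable M01 (\<lambda>x. (f x)\<^sup>2)"
    by (rule Bochner_Integration.integrable_bound[OF g]) (use assms le in \<open>auto elim!: eventually_mono\<close>)
qed

lemma L2norm_le_bound:
  assumes "f \<in> borel_measurable M01" "AE x in M01. \<bar>f x\<bar> \<le> B"
  shows "L2norm f \<le> \<bar>B\<bar>"
proof -
  have "L2norm f \<le> L2norm (\<lambda>_. B)"
    by (rule L2norm_mono_AE[OF assms(1) L2_const]) (use assms(2) in \<open>auto elim!: eventually_mono\<close>)
  then show ?thesis by simp
qed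

lemma L1_le_L2norm:
  assumes "f \<in> L2"
  shows "(\<integral>x. \<bar>f x\<bar> \<partial>M01) \<le> L2norm f"
proof -
  have "(\<lambda>x. \<bar>f x\<bar>) \<in> L2" using assms by (auto simp: L2_def)
  from ip_Cauchy_Schwarz[OF this L2_const[of 1]] show ?thesis
    by (simp add: ip_def) (simp add: L2norm_def)
qed

lemma integral_le_L2norm: "f \<in> L2 \<Longrightarrow> \<bar>integral\<^sup>L M01 f\<bar> \<le> L2norm f"
  using ip_Cauchy_Schwarz[OF _ L2_const[of 1], of f] by (simp add: ip_def)

lemma prim_le_L2norm: "f \<in> L2 \<Longrightarrow> \<bar>prim f x\<bar> \<le> L2norm f"
  using prim_abs_le[OF L2_integrable] L1_le_L2norm order_trans by blast

lemma prim_diff_le_L2norm: "f \<in> L2 \<Longrightarrow> \<bar>prim f x - prim f y\<bar> \<le> L2norm f"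
  using prim_diff_abs_le[OF L2_integrable] L1_le_L2norm order_trans by blast

text \<open>\<open>H1norm\<close> refers to some chosen weak derivative. Uniqueness up to null sets
  transfers its norm to any other one, and also to a function that agrees with \<open>f0\<close>
  only almost everywhere, as the solution at time 0 does with its initial value.\<close>

lemma H1_weak_deriv:
  assumes f0: "f0 \<in> H1" and eq: "AE x in M01. f x = f0 x" and wd: "weak_deriv f g"
  shows "g \<in> L2" "L2norm f \<le> H1norm f0" "L2norm g \<le> H1norm f0"
proof -
  define g0 where "g0 = (SOME g. g \<in> L2 \<and> weak_deriv f0 g)"
  have "\<exists>g. g \<in> L2 \<and> weak_deriv f0 g" using f0 by (auto simp: H1_def)
  then have g0: "g0 \<in> L2" "weak_deriv f0 g0"
    unfolding g0_def by (metis (mono_tags, lifting) someI_ex)+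
  have ae: "AE x in M01. g x = g0 x" by (rule weak_deriv_unique[OF wd g0(2) eq])
  have m: "f \<in> borel_measurable M01" "g \<in> borel_measurable M01" "f0 \<in> borel_measurable M01"
    using wd f0 by (auto simp: weak_deriv_def H1_def L2_def)
  show "g \<in> L2" by (rule L2_cong_AE[OF g0(1) _ m(2)]) (use ae in auto)
  have n: "L2norm f = L2norm f0" "L2norm g = L2norm g0"
    using m g0 eq ae L2_measurable by (auto intro!: L2norm_cong_AE)
  have h: "H1norm f0 = sqrt ((L2norm f)\<^sup>2 + (L2norm g)\<^sup>2)"
    by (simp add: H1norm_def n g0_def)
  show "L2norm f \<le> H1norm f0" "L2norm g \<le> H1norm f0"
    unfolding h by (auto intro!: real_le_rsqrt)
qed

section \<open>Mean-free primitives and the bound of the supremum\<close>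

definition cprim :: "(real \<Rightarrow> real) \<Rightarrow> real \<Rightarrow> real" where
  "cprim f x = prim f x - integral\<^sup>L M01 (prim f)"

lemma integrable_prim: "integrable M01 f \<Longrightarrow> integrable M01 (prim f)"
  by (simp add: integrable_M01_continuous prim_continuous_on)

lemma cprim_measurable: "integrable M01 f \<Longrightarrow> cprim f \<in> borel_measurable M01"
  unfolding cprim_def[abs_def] by measurable

text \<open>The value at x is the average over y of \<open>prim f x - prim f y\<close>, an integral
  of \<open>f\<close> over an interval, so subtracting the mean costs no factor.\<close>

lemma cprim_bound:
  assumes "f \<in> L2"
  shows "\<bar>cprim f x\<bar> \<le> L2norm f"
proof -
  have pi: "integrable M01 (prim f)" by (intro integrable_prim L2_integrable assms)
  then have "cprim f x = (\<integral>y. prim f x - prim f y \<partial>M01)" by (simp add: cprim_def)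
  also have "\<bar>\<dots>\<bar> \<le> (\<integral>y. \<bar>prim f x - prim f y\<bar> \<partial>M01)" by (rule integral_abs_bound)
  also have "\<dots> \<le> (\<integral>y. L2norm f \<partial>M01)"
    using pi by (intro integral_mono prim_diff_le_L2norm assms) auto
  finally show ?thesis by simp
qed

lemma cprim_L2: "f \<in> L2 \<Longrightarrow> cprim f \<in> L2"
  by (rule L2_bounded[where B = "L2norm f"]) (auto intro!: cprim_measurable cprim_bound L2_integrable)

lemma L2norm_cprim_le: "f \<in> L2 \<Longrightarrow> L2norm (cprim f) \<le> L2norm f"
  using L2norm_le_bound[OF cprim_measurable[OF L2_integrable], of f "L2norm f"] by (simp add: cprim_bound)

lemma cprim_lin:
  assumes "f \<in> L2" "g \<in> L2"
  shows "cprim (\<lambda>x. a * f x + b * g x) x = a * cprim f x + b * cprim g x"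
proof -
  have i: "integrable M01 f" "integrable M01 g" using assms by (auto intro: L2_integrable)
  then have "prim (\<lambda>x. a * f x + b * g x) = (\<lambda>x. a * prim f x + b * prim g x)"
    by (auto simp: prim_add prim_mult)
  then show ?thesis using i by (simp add: cprim_def integrable_prim algebra_simps)
qed

lemma cprim_cong_AE:
  assumes "f \<in> borel_measurable M01" "g \<in> borel_measurable M01" "AE x in M01. f x = g x"
  shows "cprim f = cprim g"
proof -
  have "prim f = prim g" using prim_cong_AE[OF assms] by blast
  then show ?thesis by (simp add: cprim_def[abs_def])
qed

lemma weak_deriv_cprim:
  assumes "integrable M01 f"
  shows "weak_deriv (cprim f) f"
proof -
  have "weak_deriv (\<lambda>_. integral\<^sup>L M01 (prim f)) (\<lambda>_. 0)"
    unfolding weak_deriv_def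
  proof (intro conjI allI impI)
    fix \<phi> assume \<phi>: "test_fun \<phi>"
    have "integral\<^sup>L M01 (deriv \<phi>) = 0"
      using test_fun_eq_prim[OF \<phi>, of 1] test_fun_1[OF \<phi>] by (simp add: prim_1)
    then show "(\<integral>x. integral\<^sup>L M01 (prim f) * deriv \<phi> x \<partial>M01) = - (\<integral>x. 0 * \<phi> x \<partial>M01)" by simp
  qed auto
  from weak_deriv_diff[OF weak_deriv_prim[OF assms] this] show ?thesis
    by (simp add: cprim_def[abs_def])
qed

lemma cprim_weak_deriv:
  assumes "weak_deriv f g"
  shows "AE x in M01. cprim g x = f x - integral\<^sup>L M01 f"
proof -
  obtain c where c: "AE x in M01. f x = c + prim g x" using assms by (rule weak_deriv_imp_prim)
  have i: "integrable M01 g" "integrable M01 f" using assms by (auto simp: weak_deriv_def)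
  have "integral\<^sup>L M01 f = (\<integral>x. c + prim g x \<partial>M01)"
    using c by (intro integral_cong_AE) (use i in auto)
  then have "integral\<^sup>L M01 f = c + integral\<^sup>L M01 (prim g)" using i by (simp add: integrable_prim)
  with c show ?thesis by (auto simp: cprim_def elim!: eventually_mono)
qed

text \<open>The one-dimensional Sobolev embedding: almost everywhere \<open>f\<close> is its mean
  plus \<open>cprim g\<close>, and each part is bounded by an L2 norm.\<close>

lemma H1_sup_bound:
  assumes f: "f \<in> L2" and wd: "weak_deriv f g" and g: "g \<in> L2"
  shows "AE x in M01. \<bar>f x\<bar> \<le> L2norm f + L2norm g"
  using cprim_weak_deriv[OF wd]
proof eventually_elim
  case (elim x)
  then have "f x = integral\<^sup>L M01 f + cprim g x" by simp
  then show ?case using cprim_bound[OF g, of x] integral_le_L2norm[OF f] by linarith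
qed

section \<open>Differentiation in time with values in L2\<close>

definition has_L2_deriv :: "(real \<Rightarrow> real \<Rightarrow> real) \<Rightarrow> (real \<Rightarrow> real) \<Rightarrow> real \<Rightarrow> real set \<Rightarrow> bool" where
  "has_L2_deriv f f' t S \<longleftrightarrow>
    ((\<lambda>s. L2norm (\<lambda>x. (f s x - f t x) / (s - t) - f' x)) \<longlongrightarrow> 0) (at t within S)"

lemma has_L2_deriv_ip:
  assumes f: "\<And>s. s \<in> S \<Longrightarrow> f s \<in> L2" "f' \<in> L2" "has_L2_deriv f f' t S"
    and g: "\<And>s. s \<in> S \<Longrightarrow> g s \<in> L2" "g' \<in> L2" "has_L2_deriv g g' t S"
    and t: "t \<in> S"
  shows "((\<lambda>s. ip (f s) (g s)) has_real_derivative ip f' (g t) + ip (f t) g') (at t within S)"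
proof -
  define Df where "Df s x = (f s x - f t x) / (s - t)" for s x
  define Dg where "Dg s x = (g s x - g t x) / (s - t)" for s x
  define A where "A s = L2norm (\<lambda>x. Df s x - f' x)" for s
  define B where "B s = L2norm (\<lambda>x. Dg s x - g' x)" for s
  \<comment> \<open>The error in the product rule consists of one pairing with the error of each
    factor and of (s - t) times the pairing of both difference quotients; \<open>R\<close> collects
    their Cauchy-Schwarz bounds.\<close>
  define R where "R s = A s * L2norm (g t) + L2norm (f t) * B s
      + \<bar>s - t\<bar> * ((L2norm f' + A s) * (L2norm g' + B s))" for s
  have AB: "(A \<longlongrightarrow> 0) (at t within S)" "(B \<longlongrightarrow> 0) (at t within S)"
    using f(3) g(3) by (simp_all add: has_L2_deriv_def A_def[abs_def] B_def[abs_def] Df_def Dg_def)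
  have R0: "(R \<longlongrightarrow> 0 * L2norm (g t) + L2norm (f t) * 0 + \<bar>t - t\<bar> * ((L2norm f' + 0) * (L2norm g' + 0))) (at t within S)"
    unfolding R_def by (intro tendsto_intros AB)
  have bound: "\<bar>(ip (f s) (g s) - ip (f t) (g t)) / (s - t) - (ip f' (g t) + ip (f t) g')\<bar> \<le> R s"
    if s: "s \<in> S" "s \<noteq> t" for s
  proof -
    have L: "f s \<in> L2" "g s \<in> L2" "f t \<in> L2" "g t \<in> L2" using f g s t by auto
    have D: "Df s \<in> L2" "Dg s \<in> L2"
      unfolding Df_def Dg_def by (intro L2_difference_quotient L)+
    have E: "(\<lambda>x. Df s x - f' x) \<in> L2" "(\<lambda>x. Dg s x - g' x) \<in> L2" by (intro L2_diff D f(2) g(2))+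
    have fs: "f s = (\<lambda>x. 1 * f t x + (s - t) * Df s x)" and gs: "g s = (\<lambda>x. 1 * g t x + (s - t) * Dg s x)"
      using s by (auto simp: Df_def Dg_def)
    have lin_right: "ip h (\<lambda>x. a * f x + b * g x) = a * ip h f + b * ip h g"
      if "f \<in> L2" "g \<in> L2" "h \<in> L2" for f g h a b
      using ip_lin_left[OF that] by (simp add: ip_commute)
    have "ip (f s) (g s) = ip (f t) (g s) + (s - t) * ip (Df s) (g s)"
      by (subst fs) (use ip_lin_left[OF L(3) D(1) L(2), of 1 "s - t"] in simp)
    moreover have "ip (f t) (g s) = ip (f t) (g t) + (s - t) * ip (f t) (Dg s)"
      by (subst gs) (use lin_right[OF L(4) D(2) L(3), of 1 "s - t"] in simp)
    moreover have "ip (Df s) (g s) = ip (Df s) (g t) + (s - t) * ip (Df s) (Dg s)"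
      by (subst gs) (use lin_right[OF L(4) D(2) D(1), of 1 "s - t"] in simp)
    ultimately have "ip (f s) (g s) - ip (f t) (g t)
        = (s - t) * (ip (f t) (Dg s) + ip (Df s) (g t) + (s - t) * ip (Df s) (Dg s))"
      by (simp add: algebra_simps)
    then have "(ip (f s) (g s) - ip (f t) (g t)) / (s - t)
        = ip (f t) (Dg s) + ip (Df s) (g t) + (s - t) * ip (Df s) (Dg s)"
      using s by simp
    moreover have "ip (Df s) (g t) - ip f' (g t) = ip (\<lambda>x. Df s x - f' x) (g t)"
      using ip_lin_left[OF D(1) f(2) L(4), of 1 "-1"] by simp
    moreover have "ip (f t) (Dg s) - ip (f t) g' = ip (f t) (\<lambda>x. Dg s x - g' x)"
      using lin_right[OF D(2) g(2) L(3), of 1 "-1"] by simp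
    ultimately have eq: "(ip (f s) (g s) - ip (f t) (g t)) / (s - t) - (ip f' (g t) + ip (f t) g')
        = ip (\<lambda>x. Df s x - f' x) (g t) + ip (f t) (\<lambda>x. Dg s x - g' x) + (s - t) * ip (Df s) (Dg s)"
      by simp
    have "\<bar>ip (\<lambda>x. Df s x - f' x) (g t)\<bar> \<le> A s * L2norm (g t)"
      unfolding A_def by (intro ip_Cauchy_Schwarz E L)
    moreover have "\<bar>ip (f t) (\<lambda>x. Dg s x - g' x)\<bar> \<le> L2norm (f t) * B s"
      unfolding B_def by (intro ip_Cauchy_Schwarz E L)
    moreover have "\<bar>(s - t) * ip (Df s) (Dg s)\<bar> \<le> \<bar>s - t\<bar> * ((L2norm f' + A s) * (L2norm g' + B s))"
    proof -
      have "\<bar>ip (Df s) (Dg s)\<bar> \<le> L2norm (Df s) * L2norm (Dg s)" by (intro ip_Cauchy_Schwarz D)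
      also have "\<dots> \<le> (L2norm f' + A s) * (L2norm g' + B s)"
        using L2norm_le_diff[OF D(1) f(2)] L2norm_le_diff[OF D(2) g(2)]
        by (intro mult_mono) (auto simp: A_def B_def)
      finally show ?thesis by (simp add: abs_mult mult_left_mono)
    qed
    ultimately show ?thesis unfolding eq R_def by linarith
  qed
  have "((\<lambda>s. (ip (f s) (g s) - ip (f t) (g t)) / (s - t) - (ip f' (g t) + ip (f t) g')) \<longlongrightarrow> 0) (at t within S)"
    by (rule Lim_null_comparison[where g = R])
       (use bound R0 in \<open>auto simp: eventually_at_filter\<close>)
  then show ?thesis by (simp add: has_field_derivative_iff LIM_zero_iff)
qed

text \<open>\<open>cprim\<close> is linear and does not increase the L2 norm, so it commutes with
  the limit of the difference quotients.\<close>

lemma has_L2_deriv_cprim: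
  assumes f: "\<And>s. s \<in> S \<Longrightarrow> f s \<in> L2" "f' \<in> L2" "has_L2_deriv f f' t S" and t: "t \<in> S"
  shows "has_L2_deriv (\<lambda>s. cprim (f s)) (cprim f') t S"
  unfolding has_L2_deriv_def
proof (rule Lim_null_comparison)
  show "((\<lambda>s. L2norm (\<lambda>x. (f s x - f t x) / (s - t) - f' x)) \<longlongrightarrow> 0) (at t within S)"
    using f(3) by (simp add: has_L2_deriv_def)
  have "L2norm (\<lambda>x. (cprim (f s) x - cprim (f t) x) / (s - t) - cprim f' x)
      \<le> L2norm (\<lambda>x. (f s x - f t x) / (s - t) - f' x)" if "s \<in> S" for s
  proof -
    let ?D = "\<lambda>x. 1 / (s - t) * f s x + (- 1 / (s - t)) * f t x"
    have L: "f s \<in> L2" "f t \<in> L2" using f t that by auto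
    have D: "?D \<in> L2" by (intro L2_lin L)
    have "(\<lambda>x. (f s x - f t x) / (s - t) - f' x) = (\<lambda>x. 1 * ?D x + (- 1) * f' x)"
      by (auto simp: diff_divide_distrib)
    moreover have "(\<lambda>x. (cprim (f s) x - cprim (f t) x) / (s - t) - cprim f' x)
        = cprim (\<lambda>x. 1 * ?D x + (- 1) * f' x)"
      by (simp only: cprim_lin[OF D f(2)] cprim_lin[OF L] fun_eq_iff) (simp add: diff_divide_distrib)
    ultimately show ?thesis using L2norm_cprim_le[OF L2_lin[OF D f(2), of 1 "-1"]] by simp
  qed
  then show "\<forall>\<^sub>F s in at t within S. norm (L2norm (\<lambda>x. (cprim (f s) x - cprim (f t) x) / (s - t) - cprim f' x))
      \<le> L2norm (\<lambda>x. (f s x - f t x) / (s - t) - f' x)"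
    by (auto simp: eventually_at_filter)
qed

section \<open>Exponential decay for the damped wave equation\<close>

lemma deriv_nonpos_imp_le:
  fixes F :: "real \<Rightarrow> real"
  assumes der: "\<And>t. t \<in> {0..T} \<Longrightarrow> (F has_real_derivative F' t) (at t within {0..T})"
    and le: "\<And>t. t \<in> {0..T} \<Longrightarrow> F' t \<le> 0" and t: "t \<in> {0..T}"
  shows "F t \<le> F 0"
proof (rule DERIV_nonpos_imp_decreasing_open[where f = F])
  show "0 \<le> t" using t by simp
  have "continuous_on {0..T} F" using der by (rule DERIV_continuous_on)
  then show "continuous_on {0..t} F" by (rule continuous_on_subset) (use t in auto)
  fix x assume x: "0 < x" "x < t"
  then have "at x within {0..T} = at x" using t by (intro at_within_interior) auto
  with der[of x] le[of x] x t show "\<exists>y. (F has_real_derivative y) (at x) \<and> y \<le> 0" by auto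
qed

lemma exponential_decay:
  fixes F :: "real \<Rightarrow> real"
  assumes der: "\<And>t. t \<in> {0..T} \<Longrightarrow> (F has_real_derivative F' t) (at t within {0..T})"
    and le: "\<And>t. t \<in> {0..T} \<Longrightarrow> F' t \<le> - \<gamma> * F t" and t: "t \<in> {0..T}"
  shows "F t \<le> exp (- \<gamma> * t) * F 0"
proof -
  have "F t * exp (\<gamma> * t) \<le> F 0 * exp (\<gamma> * 0)"
  proof (rule deriv_nonpos_imp_le[OF _ _ t])
    fix s assume s: "s \<in> {0..T}"
    show "((\<lambda>s. F s * exp (\<gamma> * s)) has_real_derivative (F' s + \<gamma> * F s) * exp (\<gamma> * s)) (at s within {0..T})"
      by (rule derivative_eq_intros der s refl | simp add: algebra_simps)+
    show "(F' s + \<gamma> * F s) * exp (\<gamma> * s) \<le> 0"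
      using le[OF s] by (intro mult_nonpos_nonneg) auto
  qed
  then show ?thesis by (simp add: exp_minus field_simps)
qed

text \<open>In the applications \<^term>\<open>(q, v)\<close> is the difference of two solutions of the nonlinear
  system, and \<^term>\<open>- (vt + qx)\<close> is the difference of the friction terms.\<close>

locale damped_wave =
  fixes q v qt vt qx vx :: "real \<Rightarrow> real \<Rightarrow> real" and T d0 :: real
  assumes d0: "d0 > 0"
    and L2: "t \<in> {0..T} \<Longrightarrow> q t \<in> L2" "t \<in> {0..T} \<Longrightarrow> v t \<in> L2"
      "t \<in> {0..T} \<Longrightarrow> qt t \<in> L2" "t \<in> {0..T} \<Longrightarrow> vt t \<in> L2"
      "t \<in> {0..T} \<Longrightarrow> qx t \<in> L2" "t \<in> {0..T} \<Longrightarrow> vx t \<in> L2"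
    and time_deriv: "t \<in> {0..T} \<Longrightarrow> has_L2_deriv q (qt t) t {0..T}"
      "t \<in> {0..T} \<Longrightarrow> has_L2_deriv v (vt t) t {0..T}"
    and space_deriv: "t \<in> {0..T} \<Longrightarrow> weak_deriv (q t) (qx t)"
      "t \<in> {0..T} \<Longrightarrow> weak_deriv (v t) (vx t)"
    and boundary: "t \<in> {0..T} \<Longrightarrow> bval (q t) 0 = 0" "t \<in> {0..T} \<Longrightarrow> bval (q t) 1 = 0"
    and mass: "t \<in> {0..T} \<Longrightarrow> AE x in M01. qt t x = - vx t x"
    and damping: "t \<in> {0..T} \<Longrightarrow> AE x in M01. (vt t x + qx t x) * v t x \<le> - d0 * (v t x)\<^sup>2"
begin

abbreviation E :: "real \<Rightarrow> real" where
  "E t \<equiv> Energy (q t) (v t)"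

definition r :: "real \<Rightarrow> real \<Rightarrow> real" where
  "r t x = - (vt t x + qx t x)"

lemma r_L2: "t \<in> {0..T} \<Longrightarrow> r t \<in> L2"
  using L2_lin[OF L2(4) L2(5), of t t "-1" "-1"] unfolding r_def[abs_def] by simp

lemma E_eq: "E t = (ip (q t) (q t) + ip (v t) (v t)) / 2"
  by (simp add: Energy_def L2norm_power2 add_divide_distrib)

lemma ip_vt:
  assumes t: "t \<in> {0..T}" and h: "h \<in> L2"
  shows "ip (vt t) h = - ip (qx t) h - ip (r t) h"
proof -
  have "vt t = (\<lambda>x. -1 * qx t x + -1 * r t x)" by (auto simp: r_def)
  then have "ip (vt t) h = ip (\<lambda>x. -1 * qx t x + -1 * r t x) h" by simp
  also have "\<dots> = -1 * ip (qx t) h + -1 * ip (r t) h"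
    using t by (intro ip_lin_left L2 r_L2 h)
  finally show ?thesis by simp
qed

text \<open>The spatial terms cancel: \<open>ip (qt t) (q t)\<close> becomes
  \<open>ip (qx t) (v t)\<close> by the mass equation and integration by parts, where
  \<open>q\<close> vanishes at both ends, and \<open>ip (vt t) (v t)\<close> contributes its
  negative.\<close>

lemma E_deriv:
  assumes t: "t \<in> {0..T}"
  shows "(E has_real_derivative - ip (r t) (v t)) (at t within {0..T})"
proof -
  have "((\<lambda>t. (ip (q t) (q t) + ip (v t) (v t)) / 2) has_real_derivative
      ((ip (qt t) (q t) + ip (q t) (qt t)) + (ip (vt t) (v t) + ip (v t) (vt t))) / 2) (at t within {0..T})"
    using t by (intro DERIV_cdivide DERIV_add has_L2_deriv_ip L2 time_deriv)
  moreover have "ip (qt t) (q t) = ip (\<lambda>x. -1 * vx t x + 0 * vx t x) (q t)"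
    using t mass by (intro ip_cong_AE L2_measurable L2_lin L2) (auto elim!: eventually_mono)
  then have "ip (qt t) (q t) = - ip (vx t) (q t)"
    using ip_lin_left[OF L2(6) L2(6) L2(1), OF t t t, of "-1" 0] by simp
  moreover have "ip (vx t) (q t) = - ip (qx t) (v t)"
    using weak_deriv_by_parts[OF space_deriv(1) boundary space_deriv(2), OF t t t t] by (simp add: ip_def)
  ultimately show ?thesis
    using ip_vt[OF t L2(2)[OF t]] by (simp add: E_eq ip_commute[of "q t" "qt t"] ip_commute[of "v t" "vt t"])
qed

lemma r_v_ge:
  assumes t: "t \<in> {0..T}"
  shows "d0 * ip (v t) (v t) \<le> ip (r t) (v t)"
proof -
  have "(\<integral>x. d0 * (v t x * v t x) \<partial>M01) \<le> (\<integral>x. r t x * v t x \<partial>M01)"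
    using damping[OF t]
    by (intro integral_mono_AE integrable_mult_right L2_mult_integrable r_L2 L2 t)
       (auto elim!: eventually_mono simp: r_def power2_eq_square algebra_simps)
  then show ?thesis by (simp add: ip_def)
qed

lemma ip_self_nonneg: "0 \<le> ip f f"
  by (simp add: L2norm_power2[symmetric])

text \<open>Only the coercivity in \<open>damping\<close> enters, no Lipschitz constant. Hence the
  estimate is available before any bound on the supremum of the solutions.\<close>

lemma energy_nonincreasing:
  assumes "t \<in> {0..T}" shows "E t \<le> E 0"
proof (rule deriv_nonpos_imp_le[OF E_deriv _ assms])
  fix t assume "t \<in> {0..T}"
  from r_v_ge[OF this] d0 ip_self_nonneg[of "v t"] show "- ip (r t) (v t) \<le> 0"
    using mult_nonneg_nonneg[of d0 "ip (v t) (v t)"] by linarith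
qed

text \<open>Since \<^term>\<open>q\<close> vanishes at both ends, \<^term>\<open>ip (qx t) (cprim (q t))\<close> equals
  \<^term>\<open>- ip (q t) (q t)\<close>; this recovers the dissipation of \<^term>\<open>q\<close>. Subtracting the mean from the
  primitive removes the uncontrolled boundary value of \<^term>\<open>v\<close>.\<close>

lemma cross_deriv:
  assumes t: "t \<in> {0..T}"
  shows "((\<lambda>t. ip (v t) (cprim (q t))) has_real_derivative
    ip (q t) (q t) - ip (r t) (cprim (q t)) - (ip (v t) (v t) - (integral\<^sup>L M01 (v t))\<^sup>2)) (at t within {0..T})"
proof -
  have J: "cprim (q t) \<in> L2" using t by (intro cprim_L2 L2)
  have "((\<lambda>t. ip (v t) (cprim (q t))) has_real_derivative
      ip (vt t) (cprim (q t)) + ip (v t) (cprim (qt t))) (at t within {0..T})"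
    using t by (intro has_L2_deriv_ip has_L2_deriv_cprim cprim_L2 L2 time_deriv)
  moreover have "ip (vt t) (cprim (q t)) = - ip (qx t) (cprim (q t)) - ip (r t) (cprim (q t))"
    by (rule ip_vt[OF t J])
  moreover have "ip (qx t) (cprim (q t)) = - ip (q t) (q t)"
    using weak_deriv_by_parts[OF space_deriv(1) boundary weak_deriv_cprim, OF t t t L2_integrable, OF L2(1)[OF t]]
    by (simp add: ip_def)
  \<comment> \<open>Since \<open>qt\<close> is \<open>- vx\<close>, its mean-free primitive is the
    negative of \<open>v\<close> minus its mean.\<close>
  moreover have "ip (v t) (cprim (qt t)) = - (ip (v t) (v t) - (integral\<^sup>L M01 (v t))\<^sup>2)"
  proof -
    have "cprim (qt t) = cprim (\<lambda>x. -1 * vx t x + 0 * vx t x)"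
      using t mass by (intro cprim_cong_AE L2_measurable L2_lin L2) (auto elim!: eventually_mono)
    then have "cprim (qt t) = (\<lambda>x. - cprim (vx t) x)"
      using cprim_lin[OF L2(6) L2(6), OF t t, of "-1" 0] by auto
    with cprim_weak_deriv[OF space_deriv(2)[OF t]]
    have "AE x in M01. cprim (qt t) x = -1 * v t x + 1 * integral\<^sup>L M01 (v t)"
      by (auto elim!: eventually_mono)
    then have "ip (cprim (qt t)) (v t) = ip (\<lambda>x. -1 * v t x + 1 * integral\<^sup>L M01 (v t)) (v t)"
      using t by (intro ip_cong_AE L2_measurable L2_lin L2 L2_const cprim_L2)
    also have "\<dots> = -1 * ip (v t) (v t) + 1 * ip (\<lambda>_. integral\<^sup>L M01 (v t)) (v t)"
      using t by (intro ip_lin_left L2 L2_const)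
    also have "ip (\<lambda>_. integral\<^sup>L M01 (v t)) (v t) = (integral\<^sup>L M01 (v t))\<^sup>2"
      by (simp add: ip_def power2_eq_square)
    finally show ?thesis by (simp add: ip_commute)
  qed
  ultimately show ?thesis by (simp add: algebra_simps)
qed

end

text \<open>The weight of the cross term. At most 1/2, it keeps the modified energy between 1/2 and
  3/2 of the energy; the second bound lets half of the friction absorb the terms in the squared norm
  of \<open>v\<close> that the cross term creates, one of which carries
  \<open>K\<^sup>2\<close>.\<close>

definition decay_weight :: "real \<Rightarrow> real \<Rightarrow> real" where
  "decay_weight d0 K = min (1 / 2) (d0 / (2 * (1 + K\<^sup>2)))"

lemma decay_weight:
  assumes "d0 > 0"
  shows "0 < decay_weight d0 K" "decay_weight d0 K \<le> 1 / 2"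
    "decay_weight d0 K * (1 + K\<^sup>2) \<le> d0 / 2"
proof -
  have K: "0 < 1 + K\<^sup>2" by (simp add: add_pos_nonneg)
  show "0 < decay_weight d0 K" using assms K by (simp add: decay_weight_def)
  show "decay_weight d0 K \<le> 1 / 2" unfolding decay_weight_def by (rule min.cobounded1)
  have "decay_weight d0 K * (1 + K\<^sup>2) \<le> d0 / (2 * (1 + K\<^sup>2)) * (1 + K\<^sup>2)"
    using K by (intro mult_right_mono) (auto simp: decay_weight_def)
  also have "\<dots> = d0 / 2"
  proof -
    have "d0 / (2 * c) * c = d0 / 2" if "c > 0" for c using that by simp
    from this[OF K] show ?thesis .
  qed
  finally show "decay_weight d0 K * (1 + K\<^sup>2) \<le> d0 / 2" .
qed

text \<open>The modified energy F satisfies F' \<le> - \<epsilon> E and F \<le> 3/2 E, hence the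
  factor 2/3.\<close>

definition decay_rate :: "real \<Rightarrow> real \<Rightarrow> real" where
  "decay_rate d0 K = 2 / 3 * decay_weight d0 K"

lemma decay_rate_pos: "d0 > 0 \<Longrightarrow> 0 < decay_rate d0 K"
  by (simp add: decay_rate_def decay_weight)

text \<open>The Lipschitz bound is what allows \<open>ip (r t) (cprim (q t))\<close> to be estimated
  by the dissipation of \<open>v\<close> and half of that of \<open>q\<close>. The factor 3 is the
  quotient of the constants 3/2 and 1/2 comparing the modified energy with the energy.\<close>

lemma (in damped_wave) energy_decay:
  assumes lip: "\<And>t. t \<in> {0..T} \<Longrightarrow> AE x in M01. \<bar>vt t x + qx t x\<bar> \<le> K * \<bar>v t x\<bar>"
    and K: "K \<ge> 0" and t: "t \<in> {0..T}"
  shows "E t \<le> 3 * exp (- decay_rate d0 K * t) * E 0"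
proof -
  define \<epsilon> where "\<epsilon> = decay_weight d0 K"
  have \<epsilon>: "0 < \<epsilon>" "\<epsilon> \<le> 1 / 2" "\<epsilon> * (1 + K\<^sup>2) \<le> d0 / 2"
    using decay_weight[OF d0] by (auto simp: \<epsilon>_def)
  define F where "F t = E t - \<epsilon> * ip (v t) (cprim (q t))" for t
  have E_nn: "0 \<le> E t" for t by (simp add: Energy_def)
  have cs: "\<bar>\<epsilon> * ip (v t) (cprim (q t))\<bar> \<le> E t / 2" if t: "t \<in> {0..T}" for t
  proof -
    have "\<bar>ip (v t) (cprim (q t))\<bar> \<le> L2norm (v t) * L2norm (cprim (q t))"
      using t by (intro ip_Cauchy_Schwarz cprim_L2 L2)
    also have "\<dots> \<le> L2norm (v t) * L2norm (q t)"
      using t by (intro mult_left_mono L2norm_cprim_le L2) auto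
    also have "\<dots> \<le> E t"
      using sum_squares_bound[of "L2norm (v t)" "L2norm (q t)"] by (simp add: Energy_def)
    finally have "\<epsilon> * \<bar>ip (v t) (cprim (q t))\<bar> \<le> 1 / 2 * E t"
      using \<epsilon> by (intro mult_mono) auto
    then show ?thesis using \<epsilon>(1) by (simp add: abs_mult)
  qed
  have "F t \<le> exp (- decay_rate d0 K * t) * F 0"
  proof (rule exponential_decay[OF _ _ t])
    fix t assume t: "t \<in> {0..T}"
    let ?D = "- ip (r t) (v t) - \<epsilon> * (ip (q t) (q t) - ip (r t) (cprim (q t))
        - (ip (v t) (v t) - (integral\<^sup>L M01 (v t))\<^sup>2))"
    show "(F has_real_derivative ?D) (at t within {0..T})"
      unfolding F_def[abs_def] by (intro DERIV_diff DERIV_cmult E_deriv cross_deriv t)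
    define a where "a = L2norm (q t)"
    define b where "b = L2norm (v t)"
    have ab: "ip (q t) (q t) = a\<^sup>2" "ip (v t) (v t) = b\<^sup>2" by (simp_all add: a_def b_def L2norm_power2)
    have nn: "0 \<le> a" "0 \<le> b" by (simp_all add: a_def b_def)
    have "L2norm (r t) \<le> L2norm (\<lambda>x. K * v t x)"
      using lip[OF t] K by (intro L2norm_mono_AE L2_measurable r_L2 L2_cmult L2 t)
        (auto elim!: eventually_mono simp: r_def abs_mult)
    then have rb: "L2norm (r t) \<le> K * b" using K by (simp add: L2norm_cmult b_def)
    have "ip (r t) (cprim (q t)) \<le> L2norm (r t) * L2norm (cprim (q t))"
      using ip_Cauchy_Schwarz[OF r_L2[OF t] cprim_L2[OF L2(1)[OF t]]] by linarith
    also have "\<dots> \<le> (K * b) * a"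
      using rb L2norm_cprim_le[OF L2(1)[OF t]] K nn by (intro mult_mono) (auto simp: a_def)
    also have "\<dots> \<le> (a\<^sup>2 + K\<^sup>2 * b\<^sup>2) / 2"
      using sum_squares_bound[of "K * b" a] by (simp add: power_mult_distrib)
    finally have 1: "ip (r t) (cprim (q t)) \<le> (a\<^sup>2 + K\<^sup>2 * b\<^sup>2) / 2" .
    have 2: "d0 * b\<^sup>2 \<le> ip (r t) (v t)" using r_v_ge[OF t] by (simp add: ab)
    \<comment> \<open>The squared mean of \<open>v\<close> has the favourable sign and is
      dropped.\<close>
    have "\<epsilon> * (ip (r t) (cprim (q t)) - (integral\<^sup>L M01 (v t))\<^sup>2) \<le> \<epsilon> * ((a\<^sup>2 + K\<^sup>2 * b\<^sup>2) / 2)"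
    proof (rule mult_left_mono)
      show "ip (r t) (cprim (q t)) - (integral\<^sup>L M01 (v t))\<^sup>2 \<le> (a\<^sup>2 + K\<^sup>2 * b\<^sup>2) / 2"
        using 1 zero_le_power2[of "integral\<^sup>L M01 (v t)"] by linarith
    qed (use \<epsilon> in simp)
    then have "?D \<le> - d0 * b\<^sup>2 - \<epsilon> * a\<^sup>2 + \<epsilon> * ((a\<^sup>2 + K\<^sup>2 * b\<^sup>2) / 2) + \<epsilon> * b\<^sup>2"
    proof -
      have "?D = - ip (r t) (v t) - \<epsilon> * a\<^sup>2
          + \<epsilon> * (ip (r t) (cprim (q t)) - (integral\<^sup>L M01 (v t))\<^sup>2) + \<epsilon> * b\<^sup>2"
        unfolding ab by (simp add: algebra_simps)
      with 2 \<open>\<epsilon> * _ \<le> \<epsilon> * ((a\<^sup>2 + K\<^sup>2 * b\<^sup>2) / 2)\<close> show ?thesis by simp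
    qed
    also have "\<dots> \<le> - \<epsilon> * ((a\<^sup>2 + b\<^sup>2) / 2)"
    proof -
      \<comment> \<open>In these products the claim is linear: it amounts to 3/2 X + 1/2 Z \<le> W,
        which follows from X + Z \<le> W / 2.\<close>
      define X Y Z W where "X = \<epsilon> * b\<^sup>2" and "Y = \<epsilon> * a\<^sup>2" and "Z = \<epsilon> * (K\<^sup>2 * b\<^sup>2)" and "W = d0 * b\<^sup>2"
      have "(\<epsilon> * (1 + K\<^sup>2)) * b\<^sup>2 \<le> d0 / 2 * b\<^sup>2" by (intro mult_right_mono \<epsilon>) simp
      then have "X + Z \<le> W / 2" by (simp add: X_def Z_def W_def algebra_simps)
      moreover have "0 \<le> X" "0 \<le> Z" using \<epsilon> by (simp_all add: X_def Z_def)
      ultimately have "- W - Y + (Y + Z) / 2 + X \<le> - ((Y + X) / 2)" by argo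
      moreover have "- d0 * b\<^sup>2 - \<epsilon> * a\<^sup>2 + \<epsilon> * ((a\<^sup>2 + K\<^sup>2 * b\<^sup>2) / 2) + \<epsilon> * b\<^sup>2 = - W - Y + (Y + Z) / 2 + X"
        "- \<epsilon> * ((a\<^sup>2 + b\<^sup>2) / 2) = - ((Y + X) / 2)"
        by (auto simp: X_def Y_def Z_def W_def field_simps)
      ultimately show ?thesis by (simp only:)
    qed
    also have "(a\<^sup>2 + b\<^sup>2) / 2 = E t" by (simp add: Energy_def a_def b_def add_divide_distrib)
    also have "- \<epsilon> * E t \<le> - decay_rate d0 K * F t"
    proof -
      have "F t \<le> 3 / 2 * E t" using cs[OF t] by (simp add: F_def)
      then have "\<epsilon> * F t \<le> \<epsilon> * (3 / 2 * E t)" using \<epsilon> by (intro mult_left_mono) auto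
      then show ?thesis by (simp add: decay_rate_def \<epsilon>_def)
    qed
    finally show "?D \<le> - decay_rate d0 K * F t" .
  qed
  also have "\<dots> \<le> exp (- decay_rate d0 K * t) * (3 / 2 * E 0)"
    using cs[of 0] t by (intro mult_left_mono) (auto simp: F_def)
  finally have "F t \<le> exp (- decay_rate d0 K * t) * (3 / 2 * E 0)" .
  moreover have "E t / 2 \<le> F t" using cs[OF t] by (simp add: F_def)
  ultimately show ?thesis by simp
qed

section \<open>Time derivatives in the square integrable sense\<close>

lemma has_L2_deriv_diff:
  assumes f: "\<And>s. s \<in> S \<Longrightarrow> f s \<in> L2" "f' \<in> L2" "has_L2_deriv f f' t S"
    and g: "\<And>s. s \<in> S \<Longrightarrow> g s \<in> L2" "g' \<in> L2" "has_L2_deriv g g' t S"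
    and t: "t \<in> S"
  shows "has_L2_deriv (\<lambda>s x. f s x - g s x) (\<lambda>x. f' x - g' x) t S"
  unfolding has_L2_deriv_def
proof (rule Lim_null_comparison)
  let ?A = "\<lambda>s x. (f s x - f t x) / (s - t) - f' x" and ?B = "\<lambda>s x. (g s x - g t x) / (s - t) - g' x"
  show "((\<lambda>s. L2norm (?A s) + L2norm (?B s)) \<longlongrightarrow> 0) (at t within S)"
    using tendsto_add[of "\<lambda>s. L2norm (?A s)" 0 _ "\<lambda>s. L2norm (?B s)" 0] f(3) g(3)
    by (simp add: has_L2_deriv_def)
  have "L2norm (\<lambda>x. (f s x - g s x - (f t x - g t x)) / (s - t) - (f' x - g' x)) \<le> L2norm (?A s) + L2norm (?B s)"
    if "s \<in> S" for s
  proof -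
    have "(\<lambda>x. (f s x - g s x - (f t x - g t x)) / (s - t) - (f' x - g' x)) = (\<lambda>x. ?A s x - ?B s x)"
      by (auto simp: diff_divide_distrib)
    moreover have "?A s \<in> L2" "?B s \<in> L2"
      using f g t that by (auto intro!: L2_diff L2_difference_quotient)
    ultimately show ?thesis using L2norm_triangle_diff by simp
  qed
  then show "\<forall>\<^sub>F s in at t within S. norm (L2norm (\<lambda>x. (f s x - g s x - (f t x - g t x)) / (s - t) - (f' x - g' x)))
      \<le> L2norm (?A s) + L2norm (?B s)"
    by (auto simp: eventually_at_filter)
qed

lemma has_L2_deriv_shift:
  assumes "has_L2_deriv f f' (t + s) {0..T}" "0 \<le> s" "s + T' \<le> T"
  shows "has_L2_deriv (\<lambda>t. f (t + s)) f' t {0..T'}"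
proof -
  have "filterlim (\<lambda>u. u + s) (at (t + s) within {0..T}) (at t within {0..T'})"
    unfolding filterlim_at
  proof
    show "\<forall>\<^sub>F u in at t within {0..T'}. u + s \<in> {0..T} \<and> u + s \<noteq> t + s"
      using assms by (auto simp: eventually_at_filter)
    show "((\<lambda>u. u + s) \<longlongrightarrow> t + s) (at t within {0..T'})" by (intro tendsto_intros)
  qed
  from filterlim_compose[OF assms(1)[unfolded has_L2_deriv_def] this] show ?thesis
    by (simp add: has_L2_deriv_def)
qed

lemma has_L2_deriv_right_quotient:
  assumes f: "\<And>s. s \<in> {0..T} \<Longrightarrow> f s \<in> L2" "f' \<in> L2" "has_L2_deriv f f' t {0..T}" and t: "0 \<le> t" "t < T"
  shows "((\<lambda>s. L2norm (\<lambda>x. (f (t + s) x - f t x) / s)) \<longlongrightarrow> L2norm f') (at_right 0)"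
proof -
  have ev: "\<forall>\<^sub>F s in at_right 0. 0 < s \<and> s < T - t"
    using t eventually_at_right_real[of 0 "T - t"] by simp
  have "filterlim (\<lambda>s. t + s) (at t within {0..T}) (at_right 0)"
    unfolding filterlim_at
  proof
    show "\<forall>\<^sub>F s in at_right 0. t + s \<in> {0..T} \<and> t + s \<noteq> t"
      using ev by eventually_elim (use t in auto)
    have "((\<lambda>s. t + s) \<longlongrightarrow> t + 0) (at_right 0)" by (intro tendsto_intros)
    then show "((\<lambda>s. t + s) \<longlongrightarrow> t) (at_right 0)" by simp
  qed
  from filterlim_compose[OF f(3)[unfolded has_L2_deriv_def] this]
  have lim: "((\<lambda>s. L2norm (\<lambda>x. (f (t + s) x - f t x) / s - f' x)) \<longlongrightarrow> 0) (at_right 0)" by simp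
  have "((\<lambda>s. L2norm (\<lambda>x. (f (t + s) x - f t x) / s) - L2norm f') \<longlongrightarrow> 0) (at_right 0)"
    by (rule Lim_null_comparison[OF _ lim])
       (use ev in \<open>eventually_elim, use t f(1,2) in \<open>auto intro!: L2norm_abs_diff_le L2_difference_quotient\<close>\<close>)
  then show ?thesis by (simp add: LIM_zero_iff)
qed

lemma L2norm_tendsto:
  assumes "\<And>s. s \<in> S \<Longrightarrow> f s \<in> L2" "t \<in> S" "((\<lambda>s. L2norm (f s - f t)) \<longlongrightarrow> 0) (at t within S)"
  shows "((\<lambda>s. L2norm (f s)) \<longlongrightarrow> L2norm (f t)) (at t within S)"
proof -
  have "\<bar>L2norm (f s) - L2norm (f t)\<bar> \<le> L2norm (f s - f t)" if "s \<in> S" for s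
    using that L2norm_abs_diff_le assms(1,2) by (simp add: fun_diff_def)
  then have "((\<lambda>s. L2norm (f s) - L2norm (f t)) \<longlongrightarrow> 0) (at t within S)"
    by (intro Lim_null_comparison[OF _ assms(3)]) (simp add: eventually_at_filter)
  then show ?thesis by (simp add: LIM_zero_iff)
qed

lemma Energy_le:
  assumes "L2norm f \<le> a" "L2norm g \<le> b"
  shows "Energy f g \<le> (a\<^sup>2 + b\<^sup>2) / 2"
  using power_mono[OF assms(1), of 2] power_mono[OF assms(2), of 2] by (simp add: Energy_def)

lemma L2norm_le_Energy:
  assumes "Energy f g \<le> e"
  shows "L2norm f \<le> sqrt (2 * e)" "L2norm g \<le> sqrt (2 * e)"
proof -
  have "(L2norm f)\<^sup>2 / 2 + (L2norm g)\<^sup>2 / 2 \<le> e" using assms by (simp add: Energy_def)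
  then have "(L2norm f)\<^sup>2 \<le> 2 * e" "(L2norm g)\<^sup>2 \<le> 2 * e"
    using zero_le_power2[of "L2norm f"] zero_le_power2[of "L2norm g"] by linarith+
  then show "L2norm f \<le> sqrt (2 * e)" "L2norm g \<le> sqrt (2 * e)" by (auto intro: real_le_rsqrt)
qed

lemma Energy_divide: "Energy (\<lambda>x. f x / c) (\<lambda>x. g x / c) = Energy f g / c\<^sup>2"
proof -
  have "L2norm (\<lambda>x. h x / c) = L2norm h / \<bar>c\<bar>" for h
    using L2norm_cmult[of "1 / c" h] by simp
  then show ?thesis by (simp add: Energy_def power_divide add_divide_distrib)
qed

text \<open>Dividing \<open>incr\<close> by the square of s and letting s tend to 0 from the right
  turns differences into time derivatives, as \<open>c\<close> does not depend on s. No forward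
  quotient exists at \<open>T\<close>; there the estimate follows by continuity of
  \<open>pt\<close>, \<open>mt\<close> and \<open>c\<close>.\<close>

lemma Energy_time_deriv_le:
  assumes T: "T > 0"
    and L2: "\<And>t. t \<in> {0..T} \<Longrightarrow> p t \<in> L2" "\<And>t. t \<in> {0..T} \<Longrightarrow> m t \<in> L2"
      "\<And>t. t \<in> {0..T} \<Longrightarrow> pt t \<in> L2" "\<And>t. t \<in> {0..T} \<Longrightarrow> mt t \<in> L2"
    and deriv: "\<And>t. t \<in> {0..T} \<Longrightarrow> has_L2_deriv p (pt t) t {0..T}"
      "\<And>t. t \<in> {0..T} \<Longrightarrow> has_L2_deriv m (mt t) t {0..T}"
    and cont: "((\<lambda>s. L2norm (pt s - pt T)) \<longlongrightarrow> 0) (at T within {0..T})"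
      "((\<lambda>s. L2norm (mt s - mt T)) \<longlongrightarrow> 0) (at T within {0..T})"
    and c: "isCont c T"
    and incr: "\<And>t s. 0 < s \<Longrightarrow> 0 \<le> t \<Longrightarrow> t + s \<le> T \<Longrightarrow>
      Energy (\<lambda>x. p (t + s) x - p t x) (\<lambda>x. m (t + s) x - m t x)
        \<le> c t * Energy (\<lambda>x. p s x - p 0 x) (\<lambda>x. m s x - m 0 x)"
    and t: "t \<in> {0..T}"
  shows "Energy (pt t) (mt t) \<le> c t * Energy (pt 0) (mt 0)"
proof -
  have inner: "Energy (pt t) (mt t) \<le> c t * Energy (pt 0) (mt 0)" if t: "0 \<le> t" "t < T" for t
  proof (rule tendsto_le)
    let ?Q = "\<lambda>t s. Energy (\<lambda>x. (p (t + s) x - p t x) / s) (\<lambda>x. (m (t + s) x - m t x) / s)"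
    have lim: "(?Q t \<longlongrightarrow> Energy (pt t) (mt t)) (at_right 0)" if "0 \<le> t" "t < T" for t
      unfolding Energy_def
      using that by (intro tendsto_intros has_L2_deriv_right_quotient[where T = T] L2 deriv) auto
    show "(?Q t \<longlongrightarrow> Energy (pt t) (mt t)) (at_right 0)" by (rule lim[OF t])
    show "((\<lambda>s. c t * ?Q 0 s) \<longlongrightarrow> c t * Energy (pt 0) (mt 0)) (at_right 0)"
      using T by (intro tendsto_mult_left lim) auto
    have "\<forall>\<^sub>F s in at_right 0. 0 < s \<and> s < T - t"
      using t eventually_at_right_real[of 0 "T - t"] by simp
    then show "\<forall>\<^sub>F s in at_right 0. ?Q t s \<le> c t * ?Q 0 s"
    proof eventually_elim
      case (elim s)
      with incr[of s t] t show ?case by (simp add: Energy_divide divide_right_mono)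
    qed
  qed simp
  show ?thesis
  proof (cases "t < T")
    case True
    with t inner show ?thesis by simp
  next
    case False
    with t have t: "t = T" by simp
    have "Energy (pt T) (mt T) \<le> c T * Energy (pt 0) (mt 0)"
    proof (rule tendsto_le)
      show "at T within {0..T} \<noteq> bot" using T by (simp add: trivial_limit_within islimpt_Icc)
      show "((\<lambda>s. Energy (pt s) (mt s)) \<longlongrightarrow> Energy (pt T) (mt T)) (at T within {0..T})"
        unfolding Energy_def using T by (intro tendsto_intros L2norm_tendsto L2 cont) auto
      have "(c \<longlongrightarrow> c T) (at T within {0..T})"
        using c by (meson continuous_at_imp_continuous_at_within continuous_within)
      then show "((\<lambda>s. c s * Energy (pt 0) (mt 0)) \<longlongrightarrow> c T * Energy (pt 0) (mt 0)) (at T within {0..T})"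
        by (rule tendsto_mult_right)
      show "\<forall>\<^sub>F s in at T within {0..T}. Energy (pt s) (mt s) \<le> c s * Energy (pt 0) (mt 0)"
        by (auto simp: eventually_at_filter intro!: always_eventually inner)
    qed
    with t show ?thesis by simp
  qed
qed

section \<open>The nonlinear system\<close>

locale friction =
  fixes d :: "real \<Rightarrow> real" and d0 d1 d2 pe :: real
  assumes d_C1: "d C1_differentiable_on UNIV"
    and d_zero: "d 0 = 0"
    and d0_pos: "d0 > 0" and d1_nn: "d1 \<ge> 0" and d2_nn: "d2 \<ge> 0" and pe_nn: "pe \<ge> 0"
    and d_mono: "\<And>z. deriv d z > d0"
    and d_growth: "\<And>z. \<bar>deriv d z\<bar> \<le> d1 + d2 * rpow \<bar>z\<bar> pe"
begin

text \<open>A Lipschitz constant of \<open>d\<close> on [-R, R], taken from the growth condition and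
  thus explicit in R.\<close>

definition lip :: "real \<Rightarrow> real" where
  "lip R = d1 + d2 * rpow R pe"

lemma lip_nonneg: "0 \<le> lip R"
  using d1_nn d2_nn by (simp add: lip_def rpow_def)

lemma d_deriv: "(d has_real_derivative deriv d z) (at z)"
  using d_C1 by (simp add: C1_differentiable_on_eq DERIV_deriv_iff_real_differentiable)

lemma d_deriv_le_lip:
  assumes "\<bar>z\<bar> \<le> R"
  shows "\<bar>deriv d z\<bar> \<le> lip R"
proof -
  have "rpow \<bar>z\<bar> pe \<le> rpow R pe"
    using assms pe_nn by (auto simp: rpow_def intro: powr_mono2)
  then have "d2 * rpow \<bar>z\<bar> pe \<le> d2 * rpow R pe" using d2_nn by (rule mult_left_mono)
  with d_growth[of z] show ?thesis by (simp add: lip_def)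
qed

lemma d_mean_value:
  obtains z where "\<bar>z\<bar> \<le> max \<bar>a\<bar> \<bar>b\<bar>" "d a - d b = (a - b) * deriv d z"
proof (cases a b rule: linorder_cases)
  case less
  from MVT2[OF this, of d "deriv d"] d_deriv obtain z where
    "a < z" "z < b" "d b - d a = (b - a) * deriv d z" by blast
  then show ?thesis by (intro that[of z]) (auto simp: algebra_simps)
next
  case equal
  then show ?thesis by (intro that[of a]) auto
next
  case greater
  from MVT2[OF this, of d "deriv d"] d_deriv obtain z where
    "b < z" "z < a" "d a - d b = (a - b) * deriv d z" by blast
  then show ?thesis by (intro that[of z]) auto
qed

lemma d_strongly_monotone: "d0 * (a - b)\<^sup>2 \<le> (d a - d b) * (a - b)"
proof -
  obtain z where z: "d a - d b = (a - b) * deriv d z" by (rule d_mean_value)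
  have "d0 * (a - b)\<^sup>2 \<le> deriv d z * (a - b)\<^sup>2"
    using d_mono[of z] by (intro mult_right_mono) auto
  also have "\<dots> = (d a - d b) * (a - b)" by (simp add: z power2_eq_square)
  finally show ?thesis .
qed

lemma d_Lipschitz:
  assumes "\<bar>a\<bar> \<le> R" "\<bar>b\<bar> \<le> R"
  shows "\<bar>d a - d b\<bar> \<le> lip R * \<bar>a - b\<bar>"
proof -
  obtain z where z: "\<bar>z\<bar> \<le> max \<bar>a\<bar> \<bar>b\<bar>" "d a - d b = (a - b) * deriv d z" by (rule d_mean_value)
  then have "\<bar>deriv d z\<bar> \<le> lip R" using assms by (intro d_deriv_le_lip) auto
  then have "\<bar>deriv d z\<bar> * \<bar>a - b\<bar> \<le> lip R * \<bar>a - b\<bar>" by (rule mult_right_mono) simp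
  then show ?thesis by (simp add: z abs_mult mult.commute)
qed

lemma d_abs_le:
  assumes "\<bar>a\<bar> \<le> R"
  shows "\<bar>d a\<bar> \<le> lip R * R"
proof -
  have "\<bar>d a\<bar> \<le> lip R * \<bar>a\<bar>" using d_Lipschitz[of a R 0] d_zero assms by simp
  also have "\<dots> \<le> lip R * R" by (intro mult_left_mono assms lip_nonneg)
  finally show ?thesis .
qed

text \<open>One notion for the evolution, its time translates and the steady state with zero time
  derivatives, so that a single difference estimate serves all comparisons. No initial data are
  fixed, which lets translates qualify.\<close>

definition is_solution where
  "is_solution fb gb h0 h1 T p m pt mt px mx \<longleftrightarrow> (\<forall>t\<in>{0..T}.
     p t \<in> L2 \<and> m t \<in> L2 \<and> pt t \<in> L2 \<and> mt t \<in> L2 \<and> px t \<in> L2 \<and> mx t \<in> L2 \<and>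
     has_L2_deriv p (pt t) t {0..T} \<and> has_L2_deriv m (mt t) t {0..T} \<and>
     weak_deriv (p t) (px t) \<and> weak_deriv (m t) (mx t) \<and>
     (AE x in M01. pt t x + mx t x = fb x) \<and> (AE x in M01. mt t x + px t x + d (m t x) = gb x) \<and>
     bval (p t) 0 = h0 \<and> bval (p t) 1 = h1)"

lemma is_solution_shift:
  assumes "is_solution fb gb h0 h1 T p m pt mt px mx" "0 \<le> s" "s + T' \<le> T"
  shows "is_solution fb gb h0 h1 T' (\<lambda>t. p (t + s)) (\<lambda>t. m (t + s)) (\<lambda>t. pt (t + s)) (\<lambda>t. mt (t + s))
    (\<lambda>t. px (t + s)) (\<lambda>t. mx (t + s))"
  unfolding is_solution_def
proof
  fix t assume "t \<in> {0..T'}"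
  then have t: "t + s \<in> {0..T}" using assms(2,3) by auto
  note sol = assms(1)[unfolded is_solution_def, rule_format, OF t]
  have "has_L2_deriv (\<lambda>t. p (t + s)) (pt (t + s)) t {0..T'}" "has_L2_deriv (\<lambda>t. m (t + s)) (mt (t + s)) t {0..T'}"
    using sol assms(2,3) by (auto intro: has_L2_deriv_shift)
  with sol show "p (t + s) \<in> L2 \<and> m (t + s) \<in> L2 \<and> pt (t + s) \<in> L2 \<and> mt (t + s) \<in> L2 \<and> px (t + s) \<in> L2 \<and> mx (t + s) \<in> L2 \<and>
     has_L2_deriv (\<lambda>t. p (t + s)) (pt (t + s)) t {0..T'} \<and> has_L2_deriv (\<lambda>t. m (t + s)) (mt (t + s)) t {0..T'} \<and>
     weak_deriv (p (t + s)) (px (t + s)) \<and> weak_deriv (m (t + s)) (mx (t + s)) \<and>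
     (AE x in M01. pt (t + s) x + mx (t + s) x = fb x) \<and> (AE x in M01. mt (t + s) x + px (t + s) x + d (m (t + s) x) = gb x) \<and>
     bval (p (t + s)) 0 = h0 \<and> bval (p (t + s)) 1 = h1"
    by blast
qed

text \<open>Sources and boundary values cancel in the difference. The friction is not linearized:
  strong monotonicity of \<open>d\<close> gives the sign condition directly.\<close>

lemma damped_wave_difference:
  assumes 1: "is_solution fb gb h0 h1 T p m pt mt px mx"
    and 2: "is_solution fb gb h0 h1 T p' m' pt' mt' px' mx'"
  shows "damped_wave (\<lambda>t x. p t x - p' t x) (\<lambda>t x. m t x - m' t x) (\<lambda>t x. pt t x - pt' t x)
    (\<lambda>t x. mt t x - mt' t x) (\<lambda>t x. px t x - px' t x) (\<lambda>t x. mx t x - mx' t x) T d0"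
proof (rule damped_wave.intro)
  show "0 < d0" by (rule d0_pos)
  fix t assume t: "t \<in> {0..T}"
  note s1 = 1[unfolded is_solution_def, rule_format] and s2 = 2[unfolded is_solution_def, rule_format]
  show "(\<lambda>x. p t x - p' t x) \<in> L2" "(\<lambda>x. m t x - m' t x) \<in> L2" "(\<lambda>x. pt t x - pt' t x) \<in> L2"
    "(\<lambda>x. mt t x - mt' t x) \<in> L2" "(\<lambda>x. px t x - px' t x) \<in> L2" "(\<lambda>x. mx t x - mx' t x) \<in> L2"
    using s1[OF t] s2[OF t] by (blast intro: L2_diff)+
  show "has_L2_deriv (\<lambda>t x. p t x - p' t x) (\<lambda>x. pt t x - pt' t x) t {0..T}"
    "has_L2_deriv (\<lambda>t x. m t x - m' t x) (\<lambda>x. mt t x - mt' t x) t {0..T}"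
    using s1 s2 t by (intro has_L2_deriv_diff; blast)+
  show "weak_deriv (\<lambda>x. p t x - p' t x) (\<lambda>x. px t x - px' t x)"
    "weak_deriv (\<lambda>x. m t x - m' t x) (\<lambda>x. mx t x - mx' t x)"
    using s1[OF t] s2[OF t] by (blast intro: weak_deriv_diff)+
  have "bval (\<lambda>x. p t x - p' t x) a = bval (p t) a - bval (p' t) a" if "a \<in> {0..1}" for a
    using s1[OF t] s2[OF t] that bval_diff by blast
  then show "bval (\<lambda>x. p t x - p' t x) 0 = 0" "bval (\<lambda>x. p t x - p' t x) 1 = 0"
    using s1[OF t] s2[OF t] by auto
  have ae: "AE x in M01. pt t x + mx t x = fb x" "AE x in M01. pt' t x + mx' t x = fb x"
    "AE x in M01. mt t x + px t x + d (m t x) = gb x" "AE x in M01. mt' t x + px' t x + d (m' t x) = gb x"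
    using s1[OF t] s2[OF t] by blast+
  from ae(1,2) show "AE x in M01. pt t x - pt' t x = - (mx t x - mx' t x)"
    by eventually_elim simp
  from ae(3,4) show "AE x in M01. (mt t x - mt' t x + (px t x - px' t x)) * (m t x - m' t x)
      \<le> - d0 * (m t x - m' t x)\<^sup>2"
  proof eventually_elim
    case (elim x)
    then have "mt t x - mt' t x + (px t x - px' t x) = - (d (m t x) - d (m' t x))" by linarith
    then have "(mt t x - mt' t x + (px t x - px' t x)) * (m t x - m' t x)
        = - ((d (m t x) - d (m' t x)) * (m t x - m' t x))" by (simp only: mult_minus_left)
    with d_strongly_monotone[of "m t x" "m' t x"] show ?case by linarith
  qed
qed

lemma energy_difference_nonincreasing:
  assumes "is_solution fb gb h0 h1 T p m pt mt px mx" "is_solution fb gb h0 h1 T p' m' pt' mt' px' mx'"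
    and "t \<in> {0..T}"
  shows "Energy (\<lambda>x. p t x - p' t x) (\<lambda>x. m t x - m' t x)
    \<le> Energy (\<lambda>x. p 0 x - p' 0 x) (\<lambda>x. m 0 x - m' 0 x)"
  by (rule damped_wave.energy_nonincreasing[OF damped_wave_difference[OF assms(1,2)] assms(3)])

lemma energy_difference_decay:
  assumes 1: "is_solution fb gb h0 h1 T p m pt mt px mx"
    and 2: "is_solution fb gb h0 h1 T p' m' pt' mt' px' mx'"
    and bound: "\<And>t. t \<in> {0..T} \<Longrightarrow> AE x in M01. \<bar>m t x\<bar> \<le> R" "\<And>t. t \<in> {0..T} \<Longrightarrow> AE x in M01. \<bar>m' t x\<bar> \<le> R"
    and t: "t \<in> {0..T}"
  shows "Energy (\<lambda>x. p t x - p' t x) (\<lambda>x. m t x - m' t x)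
    \<le> 3 * exp (- decay_rate d0 (lip R) * t) * Energy (\<lambda>x. p 0 x - p' 0 x) (\<lambda>x. m 0 x - m' 0 x)"
proof (rule damped_wave.energy_decay[OF damped_wave_difference[OF 1 2] _ lip_nonneg t])
  fix t assume t: "t \<in> {0..T}"
  have "AE x in M01. mt t x + px t x + d (m t x) = gb x" "AE x in M01. mt' t x + px' t x + d (m' t x) = gb x"
    using 1 2 t unfolding is_solution_def by blast+
  with bound[OF t] show "AE x in M01. \<bar>mt t x - mt' t x + (px t x - px' t x)\<bar> \<le> lip R * \<bar>m t x - m' t x\<bar>"
  proof eventually_elim
    case (elim x)
    then have "mt t x - mt' t x + (px t x - px' t x) = - (d (m t x) - d (m' t x))" by linarith
    with d_Lipschitz[OF elim(1,2)] show ?case by simp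
  qed
qed

end

section \<open>A priori bounds by the data and decay with a uniform rate\<close>

context friction
begin

lemma friction_AE_bound:
  assumes "AE x in M01. \<bar>u x\<bar> \<le> R" "AE x in M01. w x = d (u x)" "w \<in> borel_measurable M01"
  shows "L2norm w \<le> lip R * \<bar>R\<bar>"
proof -
  have "AE x in M01. \<bar>w x\<bar> \<le> lip R * R"
    using assms(1,2) by eventually_elim (simp add: d_abs_le)
  from L2norm_le_bound[OF assms(3) this] show ?thesis by (simp add: abs_mult lip_nonneg)
qed

text \<open>Throughout, F, G, H, P, N bound the norms of \<open>fb\<close>, \<open>gb\<close>, the
  boundary values, and the initial values of p and m. Here F counts once for the distance of
  \<open>mb\<close> from its boundary value at 0 and once in the bound of that value; 2 * H + G
  bounds the mean of \<open>d (mb)\<close>.\<close>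

definition mb_bound :: "real \<Rightarrow> real \<Rightarrow> real \<Rightarrow> real" where
  "mb_bound F G H = 2 * F + (2 * H + G) / d0"

definition pb_bound :: "real \<Rightarrow> real \<Rightarrow> real \<Rightarrow> real" where
  "pb_bound F G H = H + (G + lip (mb_bound F G H) * \<bar>mb_bound F G H\<bar>)"

text \<open>Integrating the second steady equation over the interval gives
  \<open>\<integral> d (mb) = \<integral> gb + h0 - h1\<close>; together with the coercivity of \<open>d\<close> this bounds the
  constant of integration in \<open>mb\<close>.\<close>

lemma steady_state_bounds:
  assumes pb: "weak_deriv pb pbx" "pbx \<in> L2" "bval pb 0 = h0" "bval pb 1 = h1"
    and mb: "weak_deriv mb mbx" "mbx \<in> L2"
    and fb: "AE x in M01. mbx x = fb x" "fb \<in> L2"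
    and gb: "AE x in M01. pbx x + d (mb x) = gb x" "gb \<in> L2"
    and H: "\<bar>h0\<bar> \<le> H" "\<bar>h1\<bar> \<le> H"
  shows "AE x in M01. \<bar>mb x\<bar> \<le> mb_bound (L2norm fb) (L2norm gb) H"
    and "AE x in M01. \<bar>pb x\<bar> \<le> pb_bound (L2norm fb) (L2norm gb) H"
proof -
  define F where "F = L2norm fb"
  define G where "G = L2norm gb"
  define c where "c = bval mb 0"
  \<comment> \<open>A representative of \<open>d (mb)\<close> whose membership in L2 comes from the
    equation.\<close>
  define w where "w x = gb x - pbx x" for x
  have w: "w \<in> L2" unfolding w_def by (intro L2_diff gb pb)
  have wd: "AE x in M01. w x = d (mb x)" using gb(1) by eventually_elim (simp add: w_def)
  have mbx: "L2norm mbx = F"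
    unfolding F_def by (intro L2norm_cong_AE L2_measurable mb fb)
  have mbc: "AE x in M01. \<bar>mb x - c\<bar> \<le> F"
    using weak_deriv_imp_bval_prim(1)[OF mb(1)]
    by eventually_elim (use prim_le_L2norm[OF mb(2)] mbx in \<open>simp add: c_def\<close>)
  have "integral\<^sup>L M01 w = integral\<^sup>L M01 gb - (h1 - h0)"
    using weak_deriv_imp_bval_prim(2)[OF pb(1)] L2_integrable[OF gb(2)] L2_integrable[OF pb(2)] pb(3,4)
    by (simp add: w_def[abs_def] prim_1)
  then have wint: "\<bar>integral\<^sup>L M01 w\<bar> \<le> 2 * H + G"
    using integral_le_L2norm[OF gb(2)] H by (simp add: G_def)
  have coercive: "d0 * k \<le> d z" if "k \<le> z" "0 < z" for k z
  proof -
    have "d0 * z * z \<le> d z * z" using d_strongly_monotone[of z 0] d_zero by (simp add: power2_eq_square mult.assoc)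
    then have "d0 * z \<le> d z" using that by simp
    moreover have "d0 * k \<le> d0 * z" using that d0_pos by simp
    ultimately show ?thesis by simp
  qed
  have coercive': "d z \<le> d0 * k" if "z \<le> k" "z < 0" for k z
  proof -
    have "d0 * z * z \<le> d z * z" using d_strongly_monotone[of z 0] d_zero by (simp add: power2_eq_square mult.assoc)
    then have "d z \<le> d0 * z" using that by (simp add: mult_le_cancel_right)
    moreover have "d0 * z \<le> d0 * k" using that d0_pos by simp
    ultimately show ?thesis by simp
  qed
  have "\<bar>c\<bar> \<le> F + (2 * H + G) / d0"
  proof -
    have nn: "0 \<le> (2 * H + G) / d0" using H d0_pos by (simp add: G_def)
    \<comment> \<open>If c exceeds F, then \<open>mb\<close> is at least c - F > 0 almost
      everywhere, so coercivity bounds the friction from below pointwise and hence in the mean; the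
      case c < - F is symmetric.\<close>
    have upper: "d0 * (c - F) \<le> 2 * H + G" if "c > F"
    proof -
      have "AE x in M01. d0 * (c - F) \<le> w x"
        using mbc wd by eventually_elim (use that in \<open>auto intro!: coercive\<close>)
      then have "(\<integral>x. d0 * (c - F) \<partial>M01) \<le> integral\<^sup>L M01 w"
        by (rule integral_mono_AE[rotated 2]) (auto intro: L2_integrable w)
      with wint show ?thesis by simp
    qed
    have lower: "- (2 * H + G) \<le> d0 * (c + F)" if "c < - F"
    proof -
      have "AE x in M01. w x \<le> d0 * (c + F)"
        using mbc wd by eventually_elim (use that in \<open>auto intro!: coercive'\<close>)
      then have "integral\<^sup>L M01 w \<le> (\<integral>x. d0 * (c + F) \<partial>M01)"
        by (rule integral_mono_AE[rotated 2]) (auto intro: L2_integrable w)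
      with wint show ?thesis by simp
    qed
    have "c - F \<le> (2 * H + G) / d0"
    proof (cases "c > F")
      case True
      with upper d0_pos show ?thesis by (simp add: pos_le_divide_eq mult.commute)
    qed (use nn in linarith)
    moreover have "- c - F \<le> (2 * H + G) / d0"
    proof (cases "c < - F")
      case True
      then have "d0 * (- c - F) \<le> 2 * H + G" using lower by (simp add: algebra_simps)
      with d0_pos show ?thesis by (simp add: pos_le_divide_eq mult.commute)
    qed (use nn in linarith)
    ultimately show ?thesis by linarith
  qed
  then have *: "AE x in M01. \<bar>mb x\<bar> \<le> 2 * F + (2 * H + G) / d0"
    using mbc by (auto elim!: eventually_mono)
  then show mbB: "AE x in M01. \<bar>mb x\<bar> \<le> mb_bound (L2norm fb) (L2norm gb) H"
    by (simp add: mb_bound_def F_def G_def)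
  have "pbx = (\<lambda>x. gb x - w x)" by (simp add: w_def)
  then have "L2norm pbx \<le> G + L2norm w" using L2norm_triangle_diff[OF gb(2) w] by (simp add: G_def)
  also have "L2norm w \<le> lip (mb_bound F G H) * \<bar>mb_bound F G H\<bar>"
    using mbB by (intro friction_AE_bound[OF _ wd] L2_measurable w) (simp add: F_def G_def)
  finally have pbx: "L2norm pbx \<le> G + lip (mb_bound F G H) * \<bar>mb_bound F G H\<bar>" by simp
  show "AE x in M01. \<bar>pb x\<bar> \<le> pb_bound (L2norm fb) (L2norm gb) H"
    using weak_deriv_imp_bval_prim(1)[OF pb(1)]
  proof eventually_elim
    case (elim x)
    with prim_le_L2norm[OF pb(2), of x] pbx H(1) pb(3) show ?case
      by (simp add: pb_bound_def F_def G_def)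
  qed
qed

definition energy_bound :: "real \<Rightarrow> real \<Rightarrow> real \<Rightarrow> real \<Rightarrow> real \<Rightarrow> real" where
  "energy_bound F G H P N = ((P + \<bar>pb_bound F G H\<bar>)\<^sup>2 + (N + \<bar>mb_bound F G H\<bar>)\<^sup>2) / 2"

text \<open>At time 0, \<open>pt\<close> is \<open>fb - mx\<close> and \<open>mt\<close> is
  \<open>gb - px - d (m)\<close>. The argument 2 * N bounds the supremum of the initial
  \<open>m\<close>, N each for the function and its derivative.\<close>

definition rate_bound :: "real \<Rightarrow> real \<Rightarrow> real \<Rightarrow> real \<Rightarrow> real" where
  "rate_bound F G P N = ((F + N)\<^sup>2 + (G + P + lip (2 * N) * \<bar>2 * N\<bar>)\<^sup>2) / 2"

text \<open>The first two summands bound the L2 norm of \<open>m\<close> by way of the steady state,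
  the bracket bounds that of \<open>mx\<close>; their sum bounds the supremum of \<open>m\<close> at
  all times.\<close>

definition sup_bound :: "real \<Rightarrow> real \<Rightarrow> real \<Rightarrow> real \<Rightarrow> real \<Rightarrow> real" where
  "sup_bound F G H P N = \<bar>mb_bound F G H\<bar> + sqrt (2 * energy_bound F G H P N)
     + (F + sqrt (2 * rate_bound F G P N))"

lemma energy_bound_nonneg: "0 \<le> energy_bound F G H P N"
  by (simp add: energy_bound_def)

lemma rate_bound_nonneg: "0 \<le> rate_bound F G P N"
  by (simp add: rate_bound_def)

lemma initial_rate_bound:
  assumes sol: "is_solution fb gb h0 h1 T p m pt mt px mx" and T: "0 \<le> T"
    and fb: "fb \<in> L2" and gb: "gb \<in> L2"
    and p0: "L2norm (px 0) \<le> P" and m0: "L2norm (m 0) \<le> N" "L2norm (mx 0) \<le> N"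
  shows "Energy (pt 0) (mt 0) \<le> rate_bound (L2norm fb) (L2norm gb) P N"
  unfolding rate_bound_def
proof (rule Energy_le)
  have "0 \<in> {0..T}" using T by simp
  note s = sol[unfolded is_solution_def, rule_format, OF this]
  have L: "m 0 \<in> L2" "pt 0 \<in> L2" "mt 0 \<in> L2" "px 0 \<in> L2" "mx 0 \<in> L2" using s by auto
  have ae: "AE x in M01. pt 0 x + mx 0 x = fb x" "AE x in M01. mt 0 x + px 0 x + d (m 0 x) = gb x"
    using s by auto
  have "L2norm (pt 0) = L2norm (\<lambda>x. fb x - mx 0 x)"
    using ae(1) by (intro L2norm_cong_AE L2_measurable L2_diff L fb) (auto elim!: eventually_mono)
  also have "\<dots> \<le> L2norm fb + N" using L2norm_triangle_diff[OF fb L(5)] m0 by simp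
  finally show "L2norm (pt 0) \<le> L2norm fb + N" .
  define w where "w x = gb x - px 0 x - mt 0 x" for x
  have w: "w \<in> L2" unfolding w_def by (intro L2_diff L gb)
  have wd: "AE x in M01. w x = d (m 0 x)" using ae(2) by eventually_elim (simp add: w_def)
  have "AE x in M01. \<bar>m 0 x\<bar> \<le> L2norm (m 0) + L2norm (mx 0)"
    using s by (intro H1_sup_bound) auto
  then have "AE x in M01. \<bar>m 0 x\<bar> \<le> 2 * N" by eventually_elim (use m0 in linarith)
  from friction_AE_bound[OF this wd L2_measurable[OF w]]
  have wn: "L2norm w \<le> lip (2 * N) * \<bar>2 * N\<bar>" .
  have "mt 0 = (\<lambda>x. (gb x - px 0 x) - w x)" by (auto simp: w_def)
  then have "L2norm (mt 0) \<le> L2norm (\<lambda>x. gb x - px 0 x) + L2norm w"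
    using L2norm_triangle_diff[OF L2_diff[OF gb L(4)] w] by simp
  also have "L2norm (\<lambda>x. gb x - px 0 x) \<le> L2norm gb + P"
    using L2norm_triangle_diff[OF gb L(4)] p0 by simp
  finally show "L2norm (mt 0) \<le> L2norm gb + P + lip (2 * N) * \<bar>2 * N\<bar>" using wn by simp
qed

lemma solution_decay:
  assumes sol: "is_solution fb gb h0 h1 T p m pt mt px mx" and T: "0 < T"
    and fb: "fb \<in> L2" and gb: "gb \<in> L2"
    and cont: "((\<lambda>s. L2norm (pt s - pt T)) \<longlongrightarrow> 0) (at T within {0..T})"
      "((\<lambda>s. L2norm (mt s - mt T)) \<longlongrightarrow> 0) (at T within {0..T})"
    and init: "L2norm (p 0) \<le> P" "L2norm (px 0) \<le> P" "L2norm (m 0) \<le> N" "L2norm (mx 0) \<le> N"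
    and steady: "is_solution fb gb h0 h1 T (\<lambda>_. pb) (\<lambda>_. mb) (\<lambda>_ _. 0) (\<lambda>_ _. 0) (\<lambda>_. pbx) (\<lambda>_. mbx)"
    and H: "\<bar>h0\<bar> \<le> H" "\<bar>h1\<bar> \<le> H"
    and \<gamma>: "\<gamma> = decay_rate d0 (lip (sup_bound (L2norm fb) (L2norm gb) H P N))"
    and t: "t \<in> {0..T}"
  shows "Energy (\<lambda>x. p t x - pb x) (\<lambda>x. m t x - mb x)
      \<le> 3 * exp (- \<gamma> * t) * energy_bound (L2norm fb) (L2norm gb) H P N"
    and "Energy (pt t) (mt t) \<le> 3 * exp (- \<gamma> * t) * rate_bound (L2norm fb) (L2norm gb) P N"
proof -
  define F where "F = L2norm fb"
  define G where "G = L2norm gb"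
  define Mb where "Mb = \<bar>mb_bound F G H\<bar>"
  define E1 where "E1 = energy_bound F G H P N"
  define E2 where "E2 = rate_bound F G P N"
  define R where "R = sup_bound F G H P N"
  have R: "R = Mb + sqrt (2 * E1) + (F + sqrt (2 * E2))"
    by (simp add: R_def sup_bound_def Mb_def E1_def E2_def)
  have E12: "0 \<le> E1" "0 \<le> E2" by (simp_all add: E1_def E2_def energy_bound_nonneg rate_bound_nonneg)
  have F: "0 \<le> F" by (simp add: F_def)
  note s = sol[unfolded is_solution_def, rule_format]
  note st = steady[unfolded is_solution_def, rule_format, of 0, simplified]
  have st': "pb \<in> L2" "mb \<in> L2" "pbx \<in> L2" "mbx \<in> L2" "weak_deriv pb pbx" "weak_deriv mb mbx"
    "AE x in M01. mbx x = fb x" "AE x in M01. pbx x + d (mb x) = gb x" "bval pb 0 = h0" "bval pb 1 = h1"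
    using st T by auto
  have mbR: "AE x in M01. \<bar>mb x\<bar> \<le> mb_bound F G H" and pbR: "AE x in M01. \<bar>pb x\<bar> \<le> pb_bound F G H"
    unfolding F_def G_def
    using steady_state_bounds[OF st'(5,3,9,10,6,4,7) fb st'(8) gb H] by auto
  have mbn: "L2norm mb \<le> Mb" "L2norm pb \<le> \<bar>pb_bound F G H\<bar>"
    using L2norm_le_bound[OF L2_measurable mbR] L2norm_le_bound[OF L2_measurable pbR] st' by (auto simp: Mb_def)
  have init_energy: "Energy (\<lambda>x. p 0 x - pb x) (\<lambda>x. m 0 x - mb x) \<le> E1"
    unfolding E1_def energy_bound_def
  proof (rule Energy_le)
    have "0 \<in> {0..T}" using T by simp
    then have "p 0 \<in> L2" "m 0 \<in> L2" using s by auto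
    with st'(1,2) show "L2norm (\<lambda>x. p 0 x - pb x) \<le> P + \<bar>pb_bound F G H\<bar>"
      "L2norm (\<lambda>x. m 0 x - mb x) \<le> N + \<bar>mb_bound F G H\<bar>"
      using L2norm_triangle_diff[of "p 0" pb] L2norm_triangle_diff[of "m 0" mb] mbn init by (auto simp: Mb_def)
  qed
  have shifted: "is_solution fb gb h0 h1 (T - s) (\<lambda>t. p (t + s)) (\<lambda>t. m (t + s)) (\<lambda>t. pt (t + s)) (\<lambda>t. mt (t + s))
    (\<lambda>t. px (t + s)) (\<lambda>t. mx (t + s))" if "0 \<le> s" for s
    using that by (intro is_solution_shift[OF sol]) auto
  \<comment> \<open>A translate by s lives on {0..T - s}, so the solution is restricted to the same
    interval before the two are compared.\<close>
  have restricted: "is_solution fb gb h0 h1 (T - s) p m pt mt px mx" if "0 \<le> s" for s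
    using is_solution_shift[OF sol, of 0 "T - s"] that by simp
  \<comment> \<open>The factor is left open: the constant 1 serves for the supremum bound, and the
    exponential is inserted once that bound is known.\<close>
  have rate: "Energy (pt t) (mt t) \<le> c t * Energy (pt 0) (mt 0)"
    if "isCont c T" "\<And>t s. 0 < s \<Longrightarrow> 0 \<le> t \<Longrightarrow> t + s \<le> T \<Longrightarrow>
      Energy (\<lambda>x. p (t + s) x - p t x) (\<lambda>x. m (t + s) x - m t x)
        \<le> c t * Energy (\<lambda>x. p s x - p 0 x) (\<lambda>x. m s x - m 0 x)" "t \<in> {0..T}" for c t
  proof (rule Energy_time_deriv_le[OF T _ _ _ _ _ _ cont that])
    fix t assume "t \<in> {0..T}"
    from s[OF this] show "p t \<in> L2" "m t \<in> L2" "pt t \<in> L2" "mt t \<in> L2"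
      "has_L2_deriv p (pt t) t {0..T}" "has_L2_deriv m (mt t) t {0..T}" by simp_all
  qed
  have E2: "Energy (pt 0) (mt 0) \<le> E2"
    unfolding E2_def F_def G_def using T init by (intro initial_rate_bound[OF sol _ fb gb]) auto
  have mR: "AE x in M01. \<bar>m t x\<bar> \<le> R" if t: "t \<in> {0..T}" for t
  proof -
    have L: "m t \<in> L2" "mx t \<in> L2" "pt t \<in> L2" and wd: "weak_deriv (m t) (mx t)"
      and ae: "AE x in M01. pt t x + mx t x = fb x" using s[OF t] by auto
    have "Energy (\<lambda>x. p t x - pb x) (\<lambda>x. m t x - mb x) \<le> E1"
      using energy_difference_nonincreasing[OF sol steady t] init_energy by simp
    then have "L2norm (\<lambda>x. m t x - mb x) \<le> sqrt (2 * E1)" by (rule L2norm_le_Energy)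
    then have m: "L2norm (m t) \<le> Mb + sqrt (2 * E1)"
      using L2norm_le_diff[OF L(1) st'(2)] mbn(1) by linarith
    have "Energy (pt t) (mt t) \<le> 1 * Energy (pt 0) (mt 0)"
    proof (rule rate[OF _ _ t])
      fix t s :: real assume "0 < s" "0 \<le> t" "t + s \<le> T"
      then show "Energy (\<lambda>x. p (t + s) x - p t x) (\<lambda>x. m (t + s) x - m t x)
          \<le> 1 * Energy (\<lambda>x. p s x - p 0 x) (\<lambda>x. m s x - m 0 x)"
        using energy_difference_nonincreasing[OF shifted restricted, of s t] by simp
    qed simp
    with E2 have "Energy (pt t) (mt t) \<le> E2" by simp
    then have pt: "L2norm (pt t) \<le> sqrt (2 * E2)" by (rule L2norm_le_Energy)
    have "L2norm (mx t) = L2norm (\<lambda>x. fb x - pt t x)"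
      using ae by (intro L2norm_cong_AE L2_measurable L2_diff L fb) (auto elim!: eventually_mono)
    also have "\<dots> \<le> F + sqrt (2 * E2)"
      using L2norm_triangle_diff[OF fb L(3)] pt by (simp add: F_def)
    finally have "L2norm (m t) + L2norm (mx t) \<le> R" using m by (simp add: R)
    with H1_sup_bound[OF L(1) wd L(2)] show ?thesis by (auto elim!: eventually_mono)
  qed
  have mbR': "AE x in M01. \<bar>mb x\<bar> \<le> R"
    using mbR
  proof eventually_elim
    case (elim x)
    have "0 \<le> sqrt (2 * E1)" "0 \<le> sqrt (2 * E2)" using E12 by auto
    with elim F show ?case unfolding R Mb_def by linarith
  qed
  have \<gamma>R: "\<gamma> = decay_rate d0 (lip R)" by (simp add: \<gamma> R_def F_def G_def)
  have "Energy (\<lambda>x. p t x - pb x) (\<lambda>x. m t x - mb x)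
      \<le> 3 * exp (- \<gamma> * t) * Energy (\<lambda>x. p 0 x - pb x) (\<lambda>x. m 0 x - mb x)"
    unfolding \<gamma>R by (rule energy_difference_decay[OF sol steady mR mbR' t])
  also have "\<dots> \<le> 3 * exp (- \<gamma> * t) * E1" using init_energy by simp
  finally show "Energy (\<lambda>x. p t x - pb x) (\<lambda>x. m t x - mb x)
      \<le> 3 * exp (- \<gamma> * t) * energy_bound (L2norm fb) (L2norm gb) H P N"
    by (simp add: E1_def F_def G_def)
  have "Energy (pt t) (mt t) \<le> 3 * exp (- \<gamma> * t) * Energy (pt 0) (mt 0)"
  proof (rule rate[OF _ _ t])
    show "isCont (\<lambda>t. 3 * exp (- \<gamma> * t)) T" by (intro continuous_intros)
    fix t s :: real assume ts: "0 < s" "0 \<le> t" "t + s \<le> T"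
    \<comment> \<open>The same R bounds the solution and all its translates, so the rate does not
      depend on s.\<close>
    have "Energy (\<lambda>x. p (t + s) x - p t x) (\<lambda>x. m (t + s) x - m t x)
        \<le> 3 * exp (- decay_rate d0 (lip R) * t) * Energy (\<lambda>x. p (0 + s) x - p 0 x) (\<lambda>x. m (0 + s) x - m 0 x)"
      by (rule energy_difference_decay[OF shifted restricted]) (use ts in \<open>auto intro!: mR\<close>)
    then show "Energy (\<lambda>x. p (t + s) x - p t x) (\<lambda>x. m (t + s) x - m t x)
        \<le> 3 * exp (- \<gamma> * t) * Energy (\<lambda>x. p s x - p 0 x) (\<lambda>x. m s x - m 0 x)"
      by (simp add: \<gamma>R)
  qed
  also have "\<dots> \<le> 3 * exp (- \<gamma> * t) * E2" using E2 by simp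
  finally show "Energy (pt t) (mt t) \<le> 3 * exp (- \<gamma> * t) * rate_bound (L2norm fb) (L2norm gb) P N"
    by (simp add: E2_def F_def G_def)
qed

end

text \<open>That the constants depend only on the five norms is expressed by the order of
  quantifiers: they are functions of these norms, chosen after \<open>d\<close> and its constants
  but before the data, the final time and the solution.\<close>

theorem theorem1:
  fixes d :: "real \<Rightarrow> real" and d0 d1 d2 pe :: real
  assumes d_C1: "d C1_differentiable_on UNIV"
    and d_zero: "d 0 = 0"
    and d0_pos: "d0 > 0" and d1_nn: "d1 \<ge> 0" and d2_nn: "d2 \<ge> 0" and pe_nn: "pe \<ge> 0"
    and d_mono: "\<And>z. deriv d z > d0"
    and d_growth: "\<And>z. \<bar>deriv d z\<bar> \<le> d1 + d2 * rpow \<bar>z\<bar> pe"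
  shows "\<exists>C C' \<gamma> :: real \<Rightarrow> real \<Rightarrow> real \<Rightarrow> real \<Rightarrow> real \<Rightarrow> real.
     (\<forall>a b c e k. C a b c e k > 0 \<and> C' a b c e k > 0 \<and> \<gamma> a b c e k > 0) \<and>
     (\<forall>(fb :: real \<Rightarrow> real) (gb :: real \<Rightarrow> real) (h0 :: real) (h1 :: real)
        (p0 :: real \<Rightarrow> real) (m0 :: real \<Rightarrow> real) (T :: real)
        (p :: real \<Rightarrow> real \<Rightarrow> real) (m :: real \<Rightarrow> real \<Rightarrow> real)
        (pt :: real \<Rightarrow> real \<Rightarrow> real) (mt :: real \<Rightarrow> real \<Rightarrow> real)
        (px :: real \<Rightarrow> real \<Rightarrow> real) (mx :: real \<Rightarrow> real \<Rightarrow> real)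
        (pb :: real \<Rightarrow> real) (mb :: real \<Rightarrow> real) (pbx :: real \<Rightarrow> real) (mbx :: real \<Rightarrow> real).
       fb \<in> L2 \<and> gb \<in> L2 \<and> p0 \<in> H1 \<and> m0 \<in> H1 \<and> T > 0
       \<comment> \<open>(p,m) in C([0,T]; H1 x H1)\<close>
       \<and> (\<forall>t\<in>{0..T}. p t \<in> H1 \<and> m t \<in> H1 \<and>
            ((\<lambda>s. H1norm (p s - p t)) \<longlongrightarrow> 0) (at t within {0..T}) \<and>
            ((\<lambda>s. H1norm (m s - m t)) \<longlongrightarrow> 0) (at t within {0..T}))
       \<comment> \<open>(p,m) in C^1([0,T]; L2 x L2) with time derivatives pt, mt\<close>
       \<and> (\<forall>t\<in>{0..T}. pt t \<in> L2 \<and> mt t \<in> L2 \<and>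
            ((\<lambda>s. L2norm (\<lambda>x. (p s x - p t x) / (s - t) - pt t x)) \<longlongrightarrow> 0) (at t within {0..T}) \<and>
            ((\<lambda>s. L2norm (\<lambda>x. (m s x - m t x) / (s - t) - mt t x)) \<longlongrightarrow> 0) (at t within {0..T}) \<and>
            ((\<lambda>s. L2norm (pt s - pt t)) \<longlongrightarrow> 0) (at t within {0..T}) \<and>
            ((\<lambda>s. L2norm (mt s - mt t)) \<longlongrightarrow> 0) (at t within {0..T}))
       \<comment> \<open>spatial weak derivatives and the equations\<close>
       \<and> (\<forall>t\<in>{0..T}. weak_deriv (p t) (px t) \<and> weak_deriv (m t) (mx t) \<and>
            (AE x in lebesgue_on {0..1}. pt t x + mx t x = fb x) \<and>
            (AE x in lebesgue_on {0..1}. mt t x + px t x + d (m t x) = gb x) \<and>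
            bval (p t) 0 = h0 \<and> bval (p t) 1 = h1)
       \<comment> \<open>initial data\<close>
       \<and> (AE x in lebesgue_on {0..1}. p 0 x = p0 x)
       \<and> (AE x in lebesgue_on {0..1}. m 0 x = m0 x)
       \<comment> \<open>steady state\<close>
       \<and> pb \<in> H1 \<and> mb \<in> H1 \<and> weak_deriv pb pbx \<and> weak_deriv mb mbx
       \<and> (AE x in lebesgue_on {0..1}. mbx x = fb x)
       \<and> (AE x in lebesgue_on {0..1}. pbx x + d (mb x) = gb x)
       \<and> bval pb 0 = h0 \<and> bval pb 1 = h1
       \<longrightarrow> (\<forall>t\<in>{0..T}.
              Energy (p t - pb) (m t - mb)
                \<le> C (L2norm fb) (L2norm gb) (norm (h0, h1)) (H1norm p0) (H1norm m0)
                   * exp (- \<gamma> (L2norm fb) (L2norm gb) (norm (h0, h1)) (H1norm p0) (H1norm m0) * t) \<and>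
              Energy (pt t) (mt t)
                \<le> C' (L2norm fb) (L2norm gb) (norm (h0, h1)) (H1norm p0) (H1norm m0)
                   * exp (- \<gamma> (L2norm fb) (L2norm gb) (norm (h0, h1)) (H1norm p0) (H1norm m0) * t)))"
proof -
  interpret friction d d0 d1 d2 pe
    by unfold_locales (fact assms)+
  \<comment> \<open>The bounds are nonnegative but can be 0; adding 1 gives the required strict
    positivity for all arguments.\<close>
  let ?C = "\<lambda>F G H P N. 3 * energy_bound F G H P N + 1"
    and ?C' = "\<lambda>F G (H::real) P N. 3 * rate_bound F G P N + 1"
    and ?\<gamma> = "\<lambda>F G H P N. decay_rate d0 (lip (sup_bound F G H P N))"
  have main: "Energy (p t - pb) (m t - mb)
        \<le> ?C (L2norm fb) (L2norm gb) (norm (h0, h1)) (H1norm p0) (H1norm m0)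
           * exp (- ?\<gamma> (L2norm fb) (L2norm gb) (norm (h0, h1)) (H1norm p0) (H1norm m0) * t) \<and>
      Energy (pt t) (mt t)
        \<le> ?C' (L2norm fb) (L2norm gb) (norm (h0, h1)) (H1norm p0) (H1norm m0)
           * exp (- ?\<gamma> (L2norm fb) (L2norm gb) (norm (h0, h1)) (H1norm p0) (H1norm m0) * t)"
    if data: "fb \<in> L2" "gb \<in> L2" "p0 \<in> H1" "m0 \<in> H1" "T > 0"
      and H1: "\<forall>t\<in>{0..T}. p t \<in> H1 \<and> m t \<in> H1 \<and>
            ((\<lambda>s. H1norm (p s - p t)) \<longlongrightarrow> 0) (at t within {0..T}) \<and>
            ((\<lambda>s. H1norm (m s - m t)) \<longlongrightarrow> 0) (at t within {0..T})"
      and C1: "\<forall>t\<in>{0..T}. pt t \<in> L2 \<and> mt t \<in> L2 \<and>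
            ((\<lambda>s. L2norm (\<lambda>x. (p s x - p t x) / (s - t) - pt t x)) \<longlongrightarrow> 0) (at t within {0..T}) \<and>
            ((\<lambda>s. L2norm (\<lambda>x. (m s x - m t x) / (s - t) - mt t x)) \<longlongrightarrow> 0) (at t within {0..T}) \<and>
            ((\<lambda>s. L2norm (pt s - pt t)) \<longlongrightarrow> 0) (at t within {0..T}) \<and>
            ((\<lambda>s. L2norm (mt s - mt t)) \<longlongrightarrow> 0) (at t within {0..T})"
      and pde: "\<forall>t\<in>{0..T}. weak_deriv (p t) (px t) \<and> weak_deriv (m t) (mx t) \<and>
            (AE x in M01. pt t x + mx t x = fb x) \<and>
            (AE x in M01. mt t x + px t x + d (m t x) = gb x) \<and>
            bval (p t) 0 = h0 \<and> bval (p t) 1 = h1"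
      and init: "AE x in M01. p 0 x = p0 x" "AE x in M01. m 0 x = m0 x"
      and steady: "pb \<in> H1" "mb \<in> H1" "weak_deriv pb pbx" "weak_deriv mb mbx"
        "AE x in M01. mbx x = fb x" "AE x in M01. pbx x + d (mb x) = gb x"
        "bval pb 0 = h0" "bval pb 1 = h1"
      and t: "t \<in> {0..T}"
    for fb gb h0 h1 p0 m0 T p m pt mt px mx pb mb pbx mbx t
  proof -
    have wd_L2: "g \<in> L2" if "f \<in> H1" "weak_deriv f g" for f g
      by (rule H1_weak_deriv(1)[OF that(1) _ that(2)]) simp
    have x_L2: "px t \<in> L2" "mx t \<in> L2" if "t \<in> {0..T}" for t
      using wd_L2[of "p t" "px t"] wd_L2[of "m t" "mx t"] H1 pde that by auto
    have sol: "is_solution fb gb h0 h1 T p m pt mt px mx"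
      unfolding is_solution_def has_L2_deriv_def using H1 C1 pde x_L2 by (auto simp: H1_def)
    have "pbx \<in> L2" "mbx \<in> L2" using steady(1-4) by (auto intro: wd_L2)
    \<comment> \<open>A function constant in time has zero difference quotients, so the steady state
      is a solution in the sense of the difference estimates.\<close>
    then have stat: "is_solution fb gb h0 h1 T (\<lambda>_. pb) (\<lambda>_. mb) (\<lambda>_ _. 0) (\<lambda>_ _. 0) (\<lambda>_. pbx) (\<lambda>_. mbx)"
      unfolding is_solution_def has_L2_deriv_def using steady by (auto simp: H1_def L2_const)
    have "0 \<in> {0..T}" using data by simp
    then have wd0: "weak_deriv (p 0) (px 0)" "weak_deriv (m 0) (mx 0)" using pde by auto
    have h: "\<bar>h0\<bar> \<le> norm (h0, h1)" "\<bar>h1\<bar> \<le> norm (h0, h1)"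
      using norm_fst_le[of h0 h1] norm_snd_le[of h1 h0] by auto
    have cont: "((\<lambda>s. L2norm (pt s - pt T)) \<longlongrightarrow> 0) (at T within {0..T})"
      "((\<lambda>s. L2norm (mt s - mt T)) \<longlongrightarrow> 0) (at T within {0..T})"
      using C1 data(5) by auto
    note decay = solution_decay[OF sol data(5,1,2) cont
        H1_weak_deriv(2,3)[OF data(3) init(1) wd0(1)] H1_weak_deriv(2,3)[OF data(4) init(2) wd0(2)]
        stat h refl t]
    have "3 * exp u * e \<le> (3 * e + 1) * exp u" for u e :: real by (simp add: algebra_simps)
    from order_trans[OF decay(1) this] order_trans[OF decay(2) this] show ?thesis
      by (simp add: fun_diff_def)
  qed
  show ?thesis
  proof (rule exI[of _ ?C], rule exI[of _ ?C'], rule exI[of _ ?\<gamma>], intro conjI allI impI ballI, goal_cases)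
    case 1 show ?case by (simp add: energy_bound_nonneg add_nonneg_pos)
  next
    case 2 show ?case by (simp add: rate_bound_nonneg add_nonneg_pos)
  next
    case 3 show ?case by (rule decay_rate_pos[OF d0_pos])
  next
    case 4 then show ?case by (elim conjE) (rule main[THEN conjunct1])
  next
    case 5 then show ?case by (elim conjE) (rule main[THEN conjunct2])
  qed
qed

end
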